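(* Let $\kappa>0$, $h>0$. Let $(A,B)$ be a random vector with $A\ge0$ and $\mathbf{E}A^\kappa=\theta\in(0,1)$, such that the distribution of $\log A$ conditioned on $A\ne0$ is arithmetic with span $h$. Let $F_\kappa$ be the (normalized) tilted distribution function of $\log A$ and $p_n=F_\kappa(nh)-F_\kappa(nh-)$, $n\in\mathbb{Z}$. Assume that $F_\kappa$ is $h$-subexponential, $F_\kappa\in\mathcal{S}_h$, that $\sup_{k\ge n}p_k=O(p_n)$ as $n\to\infty$, and that $\mathbf{E}|B|^\nu<\infty$ for some $\nu>\kappa$. Let $X$ be the unique (in distribution) solution of $X\stackrel{\mathcal{D}}{=}AX\vee B$, where $(A,B)$ and $X$ on the right-hand side are independent. Then there exists a function $q\in\mathcal{Q}_{\kappa,h}$ such that $$\lim_{n\to\infty}p_n^{-1}\,x^\kappa e^{\kappa nh}\,\mathbf{P}\{X>xe^{nh}\}=q(x),\qquad x\in C_q .$$ If $B\ge0$ a.s. and $\mathbf{P}\{B>0\}>0$, then $q(x)>0$ for all $x>0$.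
   Context: $a\vee b=\max\{a,b\}$, and $\stackrel{\mathcal{D}}{=}$ is equality in distribution. A random variable $Y$ (or its distribution) is arithmetic if $Y\in h\mathbb{Z}$ a.s. for some $h>0$; the largest such $h$ is the span of $Y$. For $A\ge0$ with $\mathbf{E}A^\kappa=\theta\in(0,1)$, the (normalized) tilted distribution function of $\log A$ is $F_\kappa(x)=\theta^{-1}\mathbf{E}[I(\log A\le x)A^\kappa]$ (the event $A=0$ contributes $0$), where $I$ denotes the indicator. Let $H$ be the distribution function of an arithmetic random variable with span $h$; put $p_k=H(kh)-H(kh-)$ and $p_k^{*2}=(H*H)(kh)-(H*H)(kh-)$, $k\in\mathbb{Z}$. $H$ is called $h$-subexponential, $H\in\mathcal{S}_h$, if $p_{n+1}\sim p_n$ and $p_n^{*2}\sim2p_n$ as $n\to\infty$. For $\kappa,h>0$, $\mathcal{Q}_{\kappa,h}$ denotes the set of functions $q:(0,\infty)\to[0,\infty)$ such that $x^{-\kappa}q(x)$ is nonincreasing and $q(xe^h)=q(x)$ for all $x>0$. $C_q$ denotes the set of continuity points of $q$. *)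

theory Defs
  imports "HOL-Probability.Probability" "HOL-Library.Landau_Symbols"
begin

definition integer_multiples :: "real \<Rightarrow> real set" where
  "integer_multiples h = range (\<lambda>k::int. of_int k * h)"

text \<open>Properties of random variables that depend only on their law are stated for measures on
  the real line. The point mass at 0 is arithmetic but has no span.\<close>

definition arithmetic_with_span :: "real measure \<Rightarrow> real \<Rightarrow> bool" where
  "arithmetic_with_span \<mu> h \<longleftrightarrow>
     h > 0 \<and> (AE y in \<mu>. y \<in> integer_multiples h) \<and>
     (\<forall>h'>0. (AE y in \<mu>. y \<in> integer_multiples h') \<longrightarrow> h' \<le> h)"

definition jump :: "(real \<Rightarrow> real) \<Rightarrow> real \<Rightarrow> real" where
  "jump H x = H x - Lim (at_left x) H"

definition lattice_mass :: "real \<Rightarrow> (real \<Rightarrow> real) \<Rightarrow> int \<Rightarrow> real" where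
  "lattice_mass h H k = jump H (of_int k * h)"

text \<open>The asymptotic equivalences are written as limits of quotients. As division by zero yields
  zero, both limits entail that the masses are eventually nonzero; the library relation
  \<open>asymp_equiv\<close> would also admit masses that vanish eventually. The measure \<open>\<mu>\<close> is determined by
  its distribution function \<open>H\<close>, and \<open>\<mu> \<star> \<mu>\<close> is the convolution of measures.\<close>

definition h_subexponential :: "real \<Rightarrow> (real \<Rightarrow> real) set" where
  "h_subexponential h = {H. \<exists>\<mu>. real_distribution \<mu> \<and> cdf \<mu> = H \<and> arithmetic_with_span \<mu> h \<and>
     ((\<lambda>n. lattice_mass h H (n + 1) / lattice_mass h H n) \<longlongrightarrow> 1) at_top \<and>
     ((\<lambda>n. lattice_mass h (cdf (\<mu> \<star> \<mu>)) n / lattice_mass h H n) \<longlongrightarrow> 2) at_top}"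

text \<open>Where \<open>A\<close> vanishes the integrand is 0, because \<open>0 powr \<kappa> = 0\<close>; the value of \<open>ln 0\<close> is
  immaterial.\<close>

definition tilted_cdf :: "'a measure \<Rightarrow> ('a \<Rightarrow> real) \<Rightarrow> real \<Rightarrow> real \<Rightarrow> real" where
  "tilted_cdf M A \<kappa> x =
     inverse (\<integral>\<omega>. A \<omega> powr \<kappa> \<partial>M) * (\<integral>\<omega>. indicator {\<omega>. ln (A \<omega>) \<le> x} \<omega> * A \<omega> powr \<kappa> \<partial>M)"

definition log_law_nonzero :: "'a measure \<Rightarrow> ('a \<Rightarrow> real) \<Rightarrow> real measure" where
  "log_law_nonzero M A =
     distr (uniform_measure M {\<omega> \<in> space M. A \<omega> \<noteq> 0}) borel (\<lambda>\<omega>. ln (A \<omega>))"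

text \<open>Equality in distribution of \<open>X\<close> and \<open>max (A * X) B\<close>. Independence of \<open>(A, B)\<close> and \<open>X\<close> on
  the right-hand side is realised on the product of their probability spaces.\<close>

definition max_equation_solution ::
    "'a measure \<Rightarrow> ('a \<Rightarrow> real) \<Rightarrow> ('a \<Rightarrow> real) \<Rightarrow> 'b measure \<Rightarrow> ('b \<Rightarrow> real) \<Rightarrow> bool" where
  "max_equation_solution M A B N X \<longleftrightarrow>
     prob_space N \<and> X \<in> borel_measurable N \<and>
     distr N borel X = distr (M \<Otimes>\<^sub>M N) borel (\<lambda>(\<omega>, \<omega>'). max (A \<omega> * X \<omega>') (B \<omega>))"

text \<open>Functions on \<open>(0, \<infinity>)\<close> are represented by functions on the reals of which only the
  values at positive arguments matter. As \<open>(0, \<infinity>)\<close> is open, continuity of \<open>q\<close> at \<open>x > 0\<close> does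
  not depend on the other values.\<close>

definition Q_class :: "real \<Rightarrow> real \<Rightarrow> (real \<Rightarrow> real) set" where
  "Q_class \<kappa> h = {q. (\<forall>x>0. q x \<ge> 0) \<and> antimono_on {0<..} (\<lambda>x. x powr (-\<kappa>) * q x) \<and>
     (\<forall>x>0. q (x * exp h) = q x)}"

definition continuity_points :: "(real \<Rightarrow> real) \<Rightarrow> real set" where
  "continuity_points q = {x. x > 0 \<and> isCont q x}"

end

theory Submission
  imports Defs
begin

text \<open>Let \<open>z n = x\<^sup>\<kappa> e\<^bsup>\<kappa>nh\<^esup> P(X > x e\<^bsup>nh\<^esup>)\<close>. Splitting the event \<open>max (A X) B > t\<close> according to whether
  \<open>A X > t\<close>, and changing to the tilted law, turns the fixed point equation into a defective renewal
  equation \<open>z = \<theta> (p * z) + g\<close> on the integers, where \<open>*\<close> is convolution and \<open>g\<close> decays exponentially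
  because \<open>B\<close> has a moment of order \<open>\<nu> > \<kappa>\<close>. Comparison with a supersolution that is a multiple of \<open>p\<close>
  far to the right shows that \<open>z = O(p)\<close>; in particular \<open>z\<close> is summable. Subexponentiality then gives
  \<open>(p * z) n = z n + p n (\<Sum> z) + o(p n)\<close>, so that \<open>z n / p n\<close> converges to \<open>\<theta> / (1 - \<theta>) \<Sum> z\<close>. This sum,
  as a function of \<open>x\<close>, is \<open>q\<close>; the convergence holds at every \<open>x > 0\<close>. If \<open>q x = 0\<close>, then
  \<open>P(X > x e\<^bsup>nh\<^esup>) = 0\<close> for all \<open>n\<close>, hence \<open>X \<le> 0\<close> and \<open>B \<le> 0\<close> almost surely.\<close>

section \<open>Subexponential masses on the integers\<close>

lemma filterlim_int_shift: "filterlim (\<lambda>n::int. n - j) at_top at_top"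
  unfolding filterlim_at_top
proof
  fix Z :: int
  show "\<forall>\<^sub>F n in at_top. Z \<le> n - j"
    using eventually_ge_at_top[of "Z + j"] by eventually_elim simp
qed

lemma eventually_int_shift:
  "\<forall>\<^sub>F n::int in at_top. P n \<Longrightarrow> \<forall>\<^sub>F n in at_top. P (n - j)"
  by (rule eventually_compose_filterlim[OF _ filterlim_int_shift])

lemma infsum_partial_tendsto:
  fixes f :: "int \<Rightarrow> real"
  assumes f: "f summable_on UNIV" and nonneg: "\<And>k. 0 \<le> f k"
  shows "((\<lambda>K. infsum f {..<K}) \<longlongrightarrow> infsum f UNIV) at_top"
proof (rule tendstoI)
  fix e :: real assume "e > 0"
  then obtain F where F: "finite F" "dist (sum f F) (infsum f UNIV) \<le> e / 2"
    using infsum_finite_approximation[OF f, of "e/2"] by auto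
  have "\<forall>\<^sub>F K in at_top. \<forall>j\<in>F. j < K"
    using F(1) by (auto simp: eventually_ball_finite_distrib)
  then show "\<forall>\<^sub>F K in at_top. dist (infsum f {..<K}) (infsum f UNIV) < e"
  proof eventually_elim
    case (elim K)
    have s: "f summable_on {..<K}" using f by (rule summable_on_subset) simp
    have "sum f F \<le> infsum f {..<K}"
      by (rule finite_sum_le_infsum[OF s F(1)]) (use elim nonneg in auto)
    moreover have "infsum f {..<K} \<le> infsum f UNIV"
      by (rule infsum_mono2[OF s f]) (use nonneg in auto)
    ultimately show ?case using F(2) \<open>e > 0\<close> by (simp add: dist_real_def abs_real_def split: if_splits)
  qed
qed

text \<open>\<open>square\<close> is the condition on the two-fold convolution with the convolution
  written out as a sum over the lattice. \<open>dominated\<close> expresses that the supremum of the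
  masses from \<open>n\<close> on is O(\<open>p n\<close>), without mentioning a supremum.\<close>

locale subexponential_masses =
  fixes p :: "int \<Rightarrow> real"
  assumes nonneg: "0 \<le> p n"
    and total: "(p has_sum 1) UNIV"
    and ratio: "((\<lambda>n. p (n + 1) / p n) \<longlongrightarrow> 1) at_top"
    and square: "((\<lambda>n. (\<Sum>\<^sub>\<infinity>j. p (n - j) * p j) / p n) \<longlongrightarrow> 2) at_top"
    and dominated: "\<exists>c. \<forall>\<^sub>F n in at_top. \<forall>k\<ge>n. p k \<le> c * p n"
begin

text \<open>Division by zero yields zero, so a quotient that exceeds 0 has a nonzero
  denominator.\<close>

lemma eventually_pos: "\<forall>\<^sub>F n in at_top. 0 < p n"
  using order_tendstoD(1)[OF ratio zero_less_one]
proof eventually_elim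
  case (elim n)
  then have "p n \<noteq> 0" by auto
  then show ?case using nonneg[of n] by simp
qed

lemma le_one: "p n \<le> 1"
  using finite_sum_le_has_sum[OF total, of "{n}"] nonneg by auto

lemma summable: "p summable_on A"
  by (rule summable_on_subset[OF has_sum_imp_summable[OF total]]) simp

text \<open>Telescoping: each further step to the left contributes the reciprocal of a quotient of
  neighbours, which tends to 1.\<close>

lemma shift_nat: "((\<lambda>n. p (n - int m) / p n) \<longlongrightarrow> 1) at_top"
proof (induction m)
  case 0
  have "\<forall>\<^sub>F n in at_top. p (n - int 0) / p n = 1"
    using eventually_pos by eventually_elim simp
  then show ?case by (rule tendsto_eventually)
next
  case (Suc m)
  have *: "((\<lambda>n. inverse (p (n - int (Suc m) + 1) / p (n - int (Suc m)))) \<longlongrightarrow> inverse 1) at_top"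
    by (intro tendsto_inverse filterlim_compose[OF ratio filterlim_int_shift]) simp
  have "((\<lambda>n. p (n - int m) / p n *
      inverse (p (n - int (Suc m) + 1) / p (n - int (Suc m)))) \<longlongrightarrow> 1 * inverse 1) at_top"
    by (rule tendsto_mult[OF Suc *])
  moreover have "\<forall>\<^sub>F n in at_top. p (n - int m) / p n *
      inverse (p (n - int (Suc m) + 1) / p (n - int (Suc m))) = p (n - int (Suc m)) / p n"
    using eventually_int_shift[OF eventually_pos, of "int m"]
    by eventually_elim (simp add: algebra_simps)
  ultimately show ?case
    using Lim_transform_eventually by fastforce
qed

lemma shift: "((\<lambda>n. p (n - j) / p n) \<longlongrightarrow> 1) at_top"
proof (cases "j \<ge> 0")
  case True
  then show ?thesis using shift_nat[of "nat j"] by simp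
next
  case False
  \<comment> \<open>Seen from the larger index \<open>n - j\<close>, the index \<open>n\<close> lies
    \<open>- j\<close> steps to the left; the case of natural shifts is applied there and
    inverted.\<close>
  have "((\<lambda>n. inverse (p ((n - j) - int (nat (- j))) / p (n - j))) \<longlongrightarrow> inverse 1) at_top"
    by (intro tendsto_inverse filterlim_compose[OF shift_nat filterlim_int_shift]) simp
  then show ?thesis using False by simp
qed

text \<open>Moving the start of the window by a fixed \<open>j\<close> costs at most a factor 2
  eventually, by \<open>shift\<close>. Replacing \<open>c\<close> by \<open>max c 1\<close> makes
  the constant positive.\<close>

lemma dominated_shift:
  "\<exists>c>0. \<forall>\<^sub>F n in at_top. \<forall>k\<ge>n - j. p k \<le> c * p n"
proof -
  obtain c where c: "\<forall>\<^sub>F n in at_top. \<forall>k\<ge>n. p k \<le> c * p n"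
    using dominated by blast
  have "\<forall>\<^sub>F n in at_top. p (n - j) / p n < 2"
    by (rule order_tendstoD(2)[OF shift]) simp
  with eventually_int_shift[OF c, of j] eventually_pos
  have "\<forall>\<^sub>F n in at_top. \<forall>k\<ge>n - j. p k \<le> (2 * max c 1) * p n"
  proof eventually_elim
    case (elim n)
    show ?case
    proof (intro allI impI)
      fix k assume "n - j \<le> k"
      then have "p k \<le> c * p (n - j)" using elim by blast
      also have "\<dots> \<le> max c 1 * p (n - j)"
        using nonneg by (intro mult_right_mono) auto
      also have "p (n - j) \<le> 2 * p n" using elim by (simp add: divide_less_eq)
      finally show "p k \<le> (2 * max c 1) * p n" by (simp add: mult_left_mono)
    qed
  qed
  then show ?thesis by (intro exI[of _ "2 * max c 1"]) auto
qed

text \<open>Dominated convergence: for fixed \<open>j\<close> the quotient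
  \<open>p (n - j) / p n\<close> tends to 1, and for \<open>j < K\<close> all indices
  \<open>n - j\<close> lie to the right of \<open>n - K\<close>, so \<open>dominated_shift\<close>
  provides a majorant \<open>c * f j\<close>.\<close>

lemma left_tail_convolution:
  assumes f: "f summable_on {..<K}" and f_nonneg: "\<And>j. 0 \<le> f j"
  shows "((\<lambda>n. (\<Sum>\<^sub>\<infinity>j\<in>{..<K}. p (n - j) * f j) / p n) \<longlongrightarrow> infsum f {..<K}) at_top"
proof -
  \<comment> \<open>The half-line is enumerated downwards from its largest element
    \<open>K - 1\<close>, since Tannery's theorem concerns series over the naturals.\<close>
  have bij: "bij_betw (\<lambda>i. K - 1 - int i) UNIV {..<K}"
    by (rule bij_betw_byWitness[where f' = "\<lambda>j. nat (K - 1 - j)"]) auto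
  define F where "F i = f (K - 1 - int i)" for i
  have FS: "(F has_sum infsum f {..<K}) UNIV"
    unfolding F_def using has_sum_reindex_bij_betw[OF bij, of f] f by simp
  obtain c where c: "c > 0" "\<forall>\<^sub>F n in at_top. \<forall>k\<ge>n - K. p k \<le> c * p n"
    using dominated_shift by blast
  have 1: "((\<lambda>n. \<Sum>i. p (n - (K - 1 - int i)) / p n * F i) \<longlongrightarrow> (\<Sum>i. 1 * F i)) at_top"
  proof (rule conjunct2[OF conjunct2[OF tannerys_theorem]])
    show "((\<lambda>n. p (n - (K - 1 - int i)) / p n * F i) \<longlongrightarrow> 1 * F i) at_top" for i
      by (intro tendsto_intros shift)
    show "\<forall>\<^sub>F (i, n) in at_top \<times>\<^sub>F at_top.
        norm (p (n - (K - 1 - int i)) / p n * F i) \<le> c * F i"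
    proof -
      \<comment> \<open>The bound holds for all \<open>i\<close> at once, so in the product filter
        only \<open>n\<close> has to be large.\<close>
      have "\<forall>\<^sub>F n in at_top. \<forall>i. norm (p (n - (K - 1 - int i)) / p n * F i) \<le> c * F i"
        using c(2) eventually_pos
      proof eventually_elim
        case (elim n)
        show ?case
        proof
          fix i
          have "p (n - (K - 1 - int i)) \<le> c * p n" using elim by auto
          then have "p (n - (K - 1 - int i)) / p n \<le> c" using elim by (simp add: divide_le_eq)
          from mult_right_mono[OF this, of "F i"]
          show "norm (p (n - (K - 1 - int i)) / p n * F i) \<le> c * F i"
            using f_nonneg nonneg elim by (simp add: F_def)
        qed
      qed
      then show ?thesis
        by (subst eventually_prod_filter, intro exI[of _ "\<lambda>_. True"] exI conjI, simp, assumption) simp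
    qed
    show "summable (\<lambda>i. c * F i)"
      using has_sum_imp_sums[OF FS] sums_summable by (intro summable_mult) blast
  qed simp
  have 2: "(\<Sum>i. 1 * F i) = infsum f {..<K}"
    using has_sum_imp_sums[OF FS] by (simp add: sums_iff)
  have 3: "(\<Sum>i. p (n - (K - 1 - int i)) / p n * F i)
      = (\<Sum>\<^sub>\<infinity>j\<in>{..<K}. p (n - j) * f j) / p n" for n
  proof -
    have "(\<lambda>j. p (n - j) * f j) summable_on {..<K}"
      using f by (rule summable_on_comparison_test)
        (use nonneg le_one f_nonneg in \<open>auto intro!: mult_left_le_one_le\<close>)
    then have "((\<lambda>j. p (n - j) * f j) has_sum (\<Sum>\<^sub>\<infinity>j\<in>{..<K}. p (n - j) * f j)) {..<K}"
      by simp
    then have "((\<lambda>i. p (n - (K - 1 - int i)) * F i) has_sum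
        (\<Sum>\<^sub>\<infinity>j\<in>{..<K}. p (n - j) * f j)) UNIV"
      unfolding F_def using has_sum_reindex_bij_betw[OF bij, of "\<lambda>j. p (n - j) * f j"] by simp
    from sums_divide[OF has_sum_imp_sums[OF this], of "p n"] show ?thesis by (simp add: sums_iff)
  qed
  show ?thesis using 1 unfolding 2 3 .
qed

section \<open>Splitting a convolution at a large index\<close>

lemma infsum_flip:
  fixes f :: "int \<Rightarrow> real"
  shows "infsum (\<lambda>j. f (n - j)) {n - K<..} = infsum f {..<K}"
  by (rule infsum_reindex_bij_witness[of _ "\<lambda>j. n - j" "\<lambda>j. n - j"]) auto

text \<open>The condition on \<open>n\<close> keeps the ranges \<open>j < K\<close>,
  \<open>K \<le> j \<le> n - K\<close> and \<open>j > n - K\<close> disjoint. The last one is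
  reflected by \<open>j \<mapsto> n - j\<close>, so that the first factor has the small
  index.\<close>

lemma convolution_split:
  assumes z: "(\<lambda>j. p (n - j) * z j) summable_on UNIV" and n: "2 * K \<le> n"
  shows "(\<Sum>\<^sub>\<infinity>j. p (n - j) * z j) = (\<Sum>\<^sub>\<infinity>j\<in>{..<K}. p (n - j) * z j)
     + (\<Sum>\<^sub>\<infinity>j\<in>{..<K}. p j * z (n - j)) + (\<Sum>j=K..n-K. p (n - j) * z j)"
proof -
  have s: "(\<lambda>j. p (n - j) * z j) summable_on A" for A
    using z by (rule summable_on_subset) simp
  have "UNIV = ({..<K} \<union> {n - K<..}) \<union> {K..n - K}" by auto
  moreover have "infsum (\<lambda>j. p (n - j) * z j) (({..<K} \<union> {n - K<..}) \<union> {K..n - K})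
     = infsum (\<lambda>j. p (n - j) * z j) {..<K} + infsum (\<lambda>j. p (n - j) * z j) {n - K<..}
      + infsum (\<lambda>j. p (n - j) * z j) {K..n - K}"
    using n by (subst infsum_Un_disjoint[OF s s], force, subst infsum_Un_disjoint[OF s s]) auto
  moreover have "infsum (\<lambda>j. p (n - j) * z j) {n - K<..} = (\<Sum>\<^sub>\<infinity>j\<in>{..<K}. p j * z (n - j))"
    using infsum_flip[of "\<lambda>j. p j * z (n - j)" n K] by simp
  ultimately show ?thesis by simp
qed

lemma summable_convolution: "(\<lambda>j. p (n - j) * p j) summable_on A"
  by (rule summable_on_comparison_test[OF summable])
     (use nonneg le_one in \<open>auto intro!: mult_left_le_one_le\<close>)

text \<open>The left half is subtracted from \<open>square\<close>. The limit decreases to 1 as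
  \<open>K\<close> grows, and since \<open>\<theta> < 1\<close> this leaves the margin exploited in
  \<open>bounded_by_masses\<close>.\<close>

lemma right_tail_convolution:
  "((\<lambda>n. (\<Sum>\<^sub>\<infinity>j\<in>{K..}. p (n - j) * p j) / p n) \<longlongrightarrow> 2 - infsum p {..<K}) at_top"
proof -
  have "(\<Sum>\<^sub>\<infinity>j. p (n - j) * p j)
      = (\<Sum>\<^sub>\<infinity>j\<in>{..<K}. p (n - j) * p j) + (\<Sum>\<^sub>\<infinity>j\<in>{K..}. p (n - j) * p j)" for n
  proof -
    have "UNIV = {..<K} \<union> {K..}" by auto
    moreover have "infsum (\<lambda>j. p (n - j) * p j) ({..<K} \<union> {K..})
      = (\<Sum>\<^sub>\<infinity>j\<in>{..<K}. p (n - j) * p j) + (\<Sum>\<^sub>\<infinity>j\<in>{K..}. p (n - j) * p j)"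
      by (intro infsum_Un_disjoint summable_convolution) auto
    ultimately show ?thesis by simp
  qed
  then have "(\<lambda>n. (\<Sum>\<^sub>\<infinity>j\<in>{K..}. p (n - j) * p j) / p n)
     = (\<lambda>n. (\<Sum>\<^sub>\<infinity>j. p (n - j) * p j) / p n - (\<Sum>\<^sub>\<infinity>j\<in>{..<K}. p (n - j) * p j) / p n)"
    by (simp add: add_divide_distrib)
  then show ?thesis
    using tendsto_diff[OF square left_tail_convolution[OF summable[of "{..<K}"] nonneg]] by simp
qed

text \<open>For the convolution square the two outer ranges of \<open>convolution_split\<close>
  coincide. The remaining limit vanishes as \<open>K\<close> grows: this is how subexponentiality
  enters the asymptotics, two large indices being negligible.\<close>

lemma middle_convolution:
  "((\<lambda>n. (\<Sum>j=K..n-K. p (n - j) * p j) / p n) \<longlongrightarrow> 2 - 2 * infsum p {..<K}) at_top"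
proof -
  have "((\<lambda>n. (\<Sum>\<^sub>\<infinity>j. p (n - j) * p j) / p n - 2 * ((\<Sum>\<^sub>\<infinity>j\<in>{..<K}. p (n - j) * p j) / p n))
     \<longlongrightarrow> 2 - 2 * infsum p {..<K}) at_top"
    by (intro tendsto_intros square left_tail_convolution[OF summable[of "{..<K}"] nonneg])
  moreover have "\<forall>\<^sub>F n in at_top. (\<Sum>\<^sub>\<infinity>j. p (n - j) * p j) / p n
      - 2 * ((\<Sum>\<^sub>\<infinity>j\<in>{..<K}. p (n - j) * p j) / p n) = (\<Sum>j=K..n-K. p (n - j) * p j) / p n"
    using eventually_ge_at_top[of "2 * K"]
  proof eventually_elim
    case (elim n)
    show ?case
      using convolution_split[OF summable_convolution elim, of]
      by (simp add: mult.commute[of "p _" "p (n - _)"] add_divide_distrib)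
  qed
  ultimately show ?thesis by (rule Lim_transform_eventually)
qed

text \<open>Quotients of neighbours tend to 1, so they eventually exceed
  \<open>exp (- (b / 2))\<close> and \<open>p\<close> decays no faster than that geometric rate.
  Half of the exponent is left over.\<close>

lemma exp_div_tendsto_0:
  assumes "b > 0"
  shows "((\<lambda>n. exp (- b * of_int n) / p n) \<longlongrightarrow> 0) at_top"
proof -
  have "exp (- (b / 2)) < 1" using assms by simp
  from order_tendstoD(1)[OF ratio this] eventually_pos
  have "\<forall>\<^sub>F n in at_top. exp (- (b / 2)) < p (n + 1) / p n \<and> 0 < p n"
    by eventually_elim simp
  then obtain N where N: "\<And>n. n \<ge> N \<Longrightarrow> exp (- (b / 2)) < p (n + 1) / p n \<and> 0 < p n"
    unfolding eventually_at_top_linorder by auto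
  \<comment> \<open>Normalised so that the lower bound below is an equality at \<open>N\<close>,
    where the induction starts.\<close>
  define c where "c = exp (b / 2 * of_int N) * p N"
  have "c > 0" using N[of N] by (simp add: c_def)
  have lower: "c * exp (- (b / 2) * of_int n) \<le> p n" if "n \<ge> N" for n
    using that
  proof (induction n rule: int_ge_induct)
    case base
    then show ?case by (simp add: c_def mult.commute mult.left_commute flip: exp_add)
  next
    case (step n)
    have "c * exp (- (b / 2) * of_int (n + 1))
        = exp (- (b / 2)) * (c * exp (- (b / 2) * of_int n))"
      by (simp add: algebra_simps flip: exp_add)
    also have "\<dots> \<le> exp (- (b / 2)) * p n" using step by simp
    also have "\<dots> \<le> p (n + 1)" using N[OF step(1)] by (metis less_imp_le pos_less_divide_eq)
    finally show ?case .
  qed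
  have "((\<lambda>n::int. exp (- (b / 2) * of_int n) / c) \<longlongrightarrow> 0 / c) at_top"
  proof (intro tendsto_divide)
    have "filterlim (\<lambda>n::int. - (b / 2 * real_of_int n)) at_bot at_top"
      unfolding filterlim_uminus_at_bot minus_minus
      by (rule filterlim_tendsto_pos_mult_at_top[OF tendsto_const])
        (use assms in \<open>simp_all add: filterlim_real_of_int_at_top\<close>)
    from filterlim_compose[OF exp_at_bot this]
    show "((\<lambda>n::int. exp (- (b / 2) * of_int n)) \<longlongrightarrow> 0) at_top" by simp
  qed (use \<open>c > 0\<close> in auto)
  then have lim: "((\<lambda>n::int. exp (- (b / 2) * of_int n) / c) \<longlongrightarrow> 0) at_top" by simp
  show ?thesis
  proof (rule tendsto_sandwich[OF _ _ tendsto_const lim])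
    show "\<forall>\<^sub>F n in at_top. 0 \<le> exp (- b * real_of_int n) / p n"
      using nonneg by (auto intro!: divide_nonneg_nonneg)
    show "\<forall>\<^sub>F n in at_top. exp (- b * real_of_int n) / p n \<le> exp (- (b / 2) * real_of_int n) / c"
      using eventually_ge_at_top[of N]
    proof eventually_elim
      case (elim n)
      have "exp (- b * real_of_int n) * c = exp (- (b / 2) * of_int n) * (c * exp (- (b / 2) * of_int n))"
        by (simp add: algebra_simps flip: exp_add)
      also have "\<dots> \<le> exp (- (b / 2) * of_int n) * p n"
        using lower[OF elim] by simp
      finally show ?case using \<open>c > 0\<close> N[OF elim] by (simp add: field_simps)
    qed
  qed
qed

end

section \<open>Defective renewal equations\<close>

lemma exp_summable_on_lessThan:
  fixes a :: real
  assumes "a > 0"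
  shows "(\<lambda>j::int. exp (a * of_int j)) summable_on {..<N}"
proof -
  have bij: "bij_betw (\<lambda>i. N - 1 - int i) UNIV {..<N}"
    by (rule bij_betw_byWitness[where f' = "\<lambda>j. nat (N - 1 - j)"]) auto
  have "summable (\<lambda>i. exp (a * of_int (N - 1)) * exp (- a) ^ i)"
    using summable_geometric[of "exp (- a)"] assms by (intro summable_mult) simp
  then have "summable (\<lambda>i. exp (a * of_int (N - 1 - int i)))"
    by (simp add: algebra_simps flip: exp_add exp_of_nat_mult)
  then have "(\<lambda>i. exp (a * of_int (N - 1 - int i))) summable_on UNIV"
    by (intro norm_summable_imp_summable_on) simp
  then show ?thesis
    using summable_on_reindex_bij_betw[OF bij, of "\<lambda>j. exp (a * of_int j)"] by simp
qed

lemma bigo_on_atLeast: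
  fixes f p :: "int \<Rightarrow> real"
  assumes ev: "\<forall>\<^sub>F n in at_top. f n \<le> c * p n" and pos: "\<And>n. n \<ge> N \<Longrightarrow> 0 < p n"
  obtains c' where "c' \<ge> 0" "\<And>n. n \<ge> N \<Longrightarrow> f n \<le> c' * p n"
proof -
  obtain n0 where n0: "\<And>n. n \<ge> n0 \<Longrightarrow> f n \<le> c * p n"
    using ev unfolding eventually_at_top_linorder by auto
  \<comment> \<open>From \<open>n0\<close> on \<open>\<bar>c\<bar>\<close> suffices; each of the
    finitely many earlier indices is covered by its own summand.\<close>
  define c' where "c' = \<bar>c\<bar> + (\<Sum>n\<in>{N..n0}. \<bar>f n\<bar> / p n)"
  have sum_nonneg: "0 \<le> (\<Sum>n\<in>{N..n0}. \<bar>f n\<bar> / p n)"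
    using pos by (intro sum_nonneg divide_nonneg_nonneg) (auto intro: less_imp_le)
  have "f n \<le> c' * p n" if "n \<ge> N" for n
  proof (cases "n \<ge> n0")
    case True
    have "f n \<le> c * p n" using n0 True .
    also have "\<dots> \<le> c' * p n"
      using sum_nonneg pos[OF that] by (intro mult_right_mono) (auto simp: c'_def)
    finally show ?thesis .
  next
    case False
    have "\<bar>f n\<bar> / p n \<le> (\<Sum>n\<in>{N..n0}. \<bar>f n\<bar> / p n)"
      using False that pos
      by (intro member_le_sum) (auto intro!: divide_nonneg_nonneg intro: less_imp_le)
    then have "\<bar>f n\<bar> / p n \<le> c'" by (simp add: c'_def)
    then have "\<bar>f n\<bar> \<le> c' * p n" using pos[OF that] by (simp add: pos_divide_le_eq)
    then show ?thesis by simp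
  qed
  moreover have "c' \<ge> 0" using sum_nonneg by (simp add: c'_def)
  ultimately show ?thesis using that by blast
qed

text \<open>In the application \<open>a\<close> is \<open>\<kappa> * h\<close>. The bound
  \<open>z_le\<close> then says that probabilities are at most 1, \<open>z_small\<close> that the
  tail of \<open>X\<close> vanishes at infinity, \<open>mgf_le\<close> that the probability of
  \<open>A \<noteq> 0\<close> is at most 1, and \<open>g_le\<close> comes from the moment of
  \<open>B\<close>. These a priori bounds are what \<open>comparison\<close> needs to control a
  solution not yet known to be bounded.\<close>

locale lattice_renewal = subexponential_masses +
  fixes z g :: "int \<Rightarrow> real" and \<theta> a D b G :: real
  assumes \<theta>: "0 < \<theta>" "\<theta> < 1" and a: "0 < a" and b: "0 < b"
    and mgf_summable: "(\<lambda>k. p k * exp (- a * of_int k)) summable_on UNIV"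
    and mgf_le: "\<theta> * (\<Sum>\<^sub>\<infinity>k. p k * exp (- a * of_int k)) \<le> 1"
    and z_nonneg: "0 \<le> z n"
    and z_le: "z n \<le> D * exp (a * of_int n)"
    and z_small: "((\<lambda>n. exp (- a * of_int n) * z n) \<longlongrightarrow> 0) at_top"
    and renewal: "z n = \<theta> * (\<Sum>\<^sub>\<infinity>j. p (n - j) * z j) + g n"
    and g_nonneg: "0 \<le> g n"
    and g_le: "g n \<le> G * exp (- b * of_int n)"
begin

section \<open>Exponential bounds and the comparison principle\<close>

lemma D_nonneg: "0 \<le> D"
  using z_nonneg[of 0] z_le[of 0] by simp

lemma p_flip: "((\<lambda>j. p (n - j)) has_sum 1) UNIV"
  using total by (rule has_sum_reindex_bij_witness[THEN iffD1, rotated -1, of _ _ _ "\<lambda>j. n - j" "\<lambda>j. n - j"]) auto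

text \<open>Exponentials are eigenfunctions of convolution; \<open>mgf_le\<close> bounds the
  eigenvalue after multiplication by \<open>\<theta>\<close>.\<close>

lemma exp_convolution:
  "((\<lambda>j. p (n - j) * exp (a * of_int j)) has_sum
     exp (a * of_int n) * (\<Sum>\<^sub>\<infinity>k. p k * exp (- a * of_int k))) UNIV"
proof -
  have "((\<lambda>k. exp (a * of_int n) * (p k * exp (- a * of_int k))) has_sum
     exp (a * of_int n) * (\<Sum>\<^sub>\<infinity>k. p k * exp (- a * of_int k))) UNIV"
    by (intro has_sum_cmult_right has_sum_infsum mgf_summable)
  then show ?thesis
    by (rule has_sum_reindex_bij_witness[THEN iffD1, rotated -1, of _ _ _ "\<lambda>j. n - j" "\<lambda>j. n - j"])
      (auto simp: algebra_simps simp flip: exp_add)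
qed

lemma summable_convolution_z: "(\<lambda>j. p (n - j) * z j) summable_on A"
proof -
  have "(\<lambda>j. D * (p (n - j) * exp (a * of_int j))) summable_on UNIV"
    by (intro summable_on_cmult_right has_sum_imp_summable[OF exp_convolution])
  then have "(\<lambda>j. D * (p (n - j) * exp (a * of_int j))) summable_on A"
    by (rule summable_on_subset) simp
  then show ?thesis
  proof (rule summable_on_comparison_test)
    show "p (n - j) * z j \<le> D * (p (n - j) * exp (a * of_int j))" for j
      using mult_left_mono[OF z_le[of j] nonneg[of "n - j"]] by (simp add: mult_ac)
  qed (auto simp: nonneg z_nonneg)
qed

text \<open>A maximum principle. The renewal operator multiplies the function \<open>n \<mapsto> exp (a * n)\<close> by at
  most 1 and constants by \<open>\<theta>\<close>, so an error of the form \<open>\<epsilon> * exp (a * n) + K\<close> is iterated away.\<close>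

lemma comparison:
  assumes v_nonneg: "\<And>n. 0 \<le> v n" and below: "\<And>n. n < N \<Longrightarrow> z n \<le> v n"
    and summable_v: "\<And>n. (\<lambda>j. p (n - j) * v j) summable_on UNIV"
    and super: "\<And>n. n \<ge> N \<Longrightarrow> \<theta> * (\<Sum>\<^sub>\<infinity>j. p (n - j) * v j) + g n \<le> v n"
  shows "z n \<le> v n"
proof -
  have approx: "z n \<le> v n + \<epsilon> * exp (a * of_int n)" if "\<epsilon> > 0" for \<epsilon>
  proof -
    have "\<forall>\<^sub>F n in at_top. exp (- a * of_int n) * z n < \<epsilon>"
      using order_tendstoD(2)[OF z_small that] .
    then obtain n0 where n0: "\<And>n. n \<ge> n0 \<Longrightarrow> exp (- a * of_int n) * z n < \<epsilon>"
      unfolding eventually_at_top_linorder by auto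
    \<comment> \<open>Right of \<open>n0\<close> the choice of \<open>n0\<close> gives the
      exponential error alone. Left of \<open>n0\<close> the trivial bound increases with
      \<open>n\<close>, so its value at \<open>n0\<close> serves as a constant.\<close>
    define K where "K = D * exp (a * of_int n0)"
    have "K \<ge> 0" using D_nonneg by (simp add: K_def)
    have base: "z n \<le> \<epsilon> * exp (a * of_int n) + K" for n
    proof (cases "n \<ge> n0")
      case True
      have "z n = exp (a * of_int n) * (exp (- a * of_int n) * z n)"
        by (simp flip: exp_add mult.assoc)
      also have "\<dots> \<le> exp (a * of_int n) * \<epsilon>"
        using n0[OF True] by (intro mult_left_mono) auto
      finally show ?thesis using \<open>K \<ge> 0\<close> by (simp add: mult.commute)
    next
      case False
      have "z n \<le> D * exp (a * of_int n)" by (rule z_le)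
      also have "\<dots> \<le> K"
        unfolding K_def using False a D_nonneg by (intro mult_left_mono) auto
      finally show ?thesis using \<open>\<epsilon> > 0\<close> by (simp add: add_increasing)
    qed
    have step: "z n \<le> v n + \<epsilon> * exp (a * of_int n) + \<theta> ^ m * K" for m n
    proof (induction m arbitrary: n)
      case 0
      show ?case using base[of n] v_nonneg[of n] by simp
    next
      case (Suc m)
      show ?case
      proof (cases "n < N")
        case True
        then show ?thesis
          using below[of n] \<open>K \<ge> 0\<close> \<open>\<epsilon> > 0\<close> \<theta> by (simp add: add_increasing2)
      next
        case False
        define \<phi> where "\<phi> = (\<Sum>\<^sub>\<infinity>k. p k * exp (- a * of_int k))"
        have "((\<lambda>j. p (n - j) * v j + \<epsilon> * (p (n - j) * exp (a * of_int j)) + p (n - j) * (\<theta> ^ m * K))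
            has_sum (\<Sum>\<^sub>\<infinity>j. p (n - j) * v j) + \<epsilon> * (exp (a * of_int n) * \<phi>) + 1 * (\<theta> ^ m * K)) UNIV"
          unfolding \<phi>_def
          by (intro has_sum_add has_sum_cmult_right has_sum_cmult_left has_sum_infsum
              exp_convolution p_flip summable_v)
        moreover have "((\<lambda>j. p (n - j) * z j) has_sum (\<Sum>\<^sub>\<infinity>j. p (n - j) * z j)) UNIV"
          by (intro has_sum_infsum summable_convolution_z)
        moreover have "p (n - j) * z j
            \<le> p (n - j) * v j + \<epsilon> * (p (n - j) * exp (a * of_int j)) + p (n - j) * (\<theta> ^ m * K)" for j
          using mult_left_mono[OF Suc.IH[of j] nonneg[of "n - j"]] by (simp add: algebra_simps)
        ultimately have le: "(\<Sum>\<^sub>\<infinity>j. p (n - j) * z j)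
            \<le> (\<Sum>\<^sub>\<infinity>j. p (n - j) * v j) + \<epsilon> * (exp (a * of_int n) * \<phi>) + 1 * (\<theta> ^ m * K)"
          using has_sum_mono by fastforce
        from mult_left_mono[OF le, of \<theta>]
        have "z n \<le> (\<theta> * (\<Sum>\<^sub>\<infinity>j. p (n - j) * v j) + g n)
            + \<epsilon> * exp (a * of_int n) * (\<theta> * \<phi>) + \<theta> ^ Suc m * K"
          using \<theta> renewal[of n] by (simp add: algebra_simps)
        moreover have "\<epsilon> * exp (a * of_int n) * (\<theta> * \<phi>) \<le> \<epsilon> * exp (a * of_int n) * 1"
          using mgf_le \<open>\<epsilon> > 0\<close> unfolding \<phi>_def by (intro mult_left_mono) auto
        ultimately show ?thesis using super[of n] False by simp
      qed
    qed
    \<comment> \<open>First \<open>m\<close> tends to infinity and removes the constant; afterwards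
      \<open>\<epsilon>\<close> tends to 0 at a fixed \<open>n\<close>.\<close>
    have "(\<lambda>m. v n + \<epsilon> * exp (a * of_int n) + \<theta> ^ m * K)
        \<longlonglongrightarrow> v n + \<epsilon> * exp (a * of_int n) + 0 * K"
      using \<theta> by (intro tendsto_intros LIMSEQ_realpow_zero) auto
    from LIMSEQ_le_const[OF this, of "z n"] step show ?thesis by auto
  qed
  show ?thesis
  proof (rule field_le_epsilon)
    fix e :: real assume "e > 0"
    then show "z n \<le> v n + e"
      using approx[of "e / exp (a * of_int n)"] by simp
  qed
qed

section \<open>Domination of the solution by the masses\<close>

lemma g_negligible: "((\<lambda>n. g n / p n) \<longlongrightarrow> 0) at_top"
proof (rule tendsto_sandwich[OF _ _ tendsto_const])
  show "((\<lambda>n. G * (exp (- b * of_int n) / p n)) \<longlongrightarrow> 0) at_top"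
    using tendsto_mult[OF tendsto_const exp_div_tendsto_0[OF b], of G] by simp
  show "\<forall>\<^sub>F n in at_top. g n / p n \<le> G * (exp (- b * of_int n) / p n)"
    using divide_right_mono[OF g_le nonneg] by (auto intro!: always_eventually)
qed (auto simp: g_nonneg nonneg)

text \<open>For \<open>K\<close> large, \<open>\<theta>\<close> times the right half of the
  convolution square is at most \<open>\<rho> * p n\<close> with \<open>\<rho> < 1\<close>. The gap
  \<open>1 - \<rho>\<close> lets a large multiple of \<open>p\<close> absorb everything else, and
  \<open>comparison\<close> applies.\<close>

lemma bounded_by_masses:
  obtains C N where "C \<ge> 0" "\<And>n. n \<ge> N \<Longrightarrow> z n \<le> C * p n" "\<And>n. n \<ge> N \<Longrightarrow> 0 < p n"
proof -
  have "((\<lambda>K. \<theta> * (2 - infsum p {..<K})) \<longlongrightarrow> \<theta> * (2 - 1)) at_top"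
    using infsum_partial_tendsto[OF summable nonneg] infsumI[OF total]
    by (intro tendsto_intros) simp
  then have "\<forall>\<^sub>F K in at_top. \<theta> * (2 - infsum p {..<K}) < 1"
    by (rule order_tendstoD) (use \<theta> in simp)
  then obtain K where K: "\<theta> * (2 - infsum p {..<K}) < 1"
    by (auto dest: eventually_happens)
  then obtain \<rho> where \<rho>: "\<theta> * (2 - infsum p {..<K}) < \<rho>" "\<rho> < 1"
    using dense by blast
  have "\<forall>\<^sub>F n in at_top. \<theta> * ((\<Sum>\<^sub>\<infinity>j\<in>{K..}. p (n - j) * p j) / p n) < \<rho>"
    by (rule order_tendstoD[OF _ \<rho>(1)]) (intro tendsto_intros right_tail_convolution)
  then have "\<forall>\<^sub>F n in at_top. K \<le> n \<and> 0 < p n \<and> \<theta> * (\<Sum>\<^sub>\<infinity>j\<in>{K..}. p (n - j) * p j) \<le> \<rho> * p n"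
    using eventually_pos eventually_ge_at_top[of K]
    by eventually_elim (simp add: field_simps)
  then obtain N where N: "\<And>n. n \<ge> N \<Longrightarrow>
      K \<le> n \<and> 0 < p n \<and> \<theta> * (\<Sum>\<^sub>\<infinity>j\<in>{K..}. p (n - j) * p j) \<le> \<rho> * p n"
    unfolding eventually_at_top_linorder by auto
  \<comment> \<open>The contribution of the trivial bound on \<open>z\<close> to the left of
    \<open>N\<close>. It is O(\<open>p n\<close>), because that bound is summable there and
    \<open>left_tail_convolution\<close> applies.\<close>
  define L where "L n = (\<Sum>\<^sub>\<infinity>j\<in>{..<N}. p (n - j) * (D * exp (a * of_int j)))" for n
  have "((\<lambda>n. \<theta> * (L n / p n) + g n / p n) \<longlongrightarrow>
      \<theta> * (\<Sum>\<^sub>\<infinity>j\<in>{..<N}. D * exp (a * of_int j)) + 0) at_top"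
    unfolding L_def using D_nonneg a
    by (intro tendsto_intros left_tail_convolution g_negligible summable_on_cmult_right
        exp_summable_on_lessThan) auto
  from order_tendstoD(2)[OF this, of "\<theta> * (\<Sum>\<^sub>\<infinity>j\<in>{..<N}. D * exp (a * of_int j)) + 1"]
  have "\<forall>\<^sub>F n in at_top. \<theta> * (L n / p n) + g n / p n < \<theta> * (\<Sum>\<^sub>\<infinity>j\<in>{..<N}. D * exp (a * of_int j)) + 1"
    by simp
  then have "\<forall>\<^sub>F n in at_top. \<theta> * L n + g n
      \<le> (\<theta> * (\<Sum>\<^sub>\<infinity>j\<in>{..<N}. D * exp (a * of_int j)) + 1) * p n"
    using eventually_pos
  proof eventually_elim
    case (elim n)
    have "\<theta> * L n + g n = (\<theta> * (L n / p n) + g n / p n) * p n"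
      using elim by (simp add: field_simps)
    also have "\<dots> \<le> (\<theta> * (\<Sum>\<^sub>\<infinity>j\<in>{..<N}. D * exp (a * of_int j)) + 1) * p n"
      using elim by (intro mult_right_mono) auto
    finally show ?case .
  qed
  then obtain c where c: "c \<ge> 0" "\<And>n. n \<ge> N \<Longrightarrow> \<theta> * L n + g n \<le> c * p n"
    using bigo_on_atLeast[of "\<lambda>n. \<theta> * L n + g n" _ p N] N by blast
  \<comment> \<open>The solution of \<open>C = c + C * \<rho>\<close>: \<open>c\<close> pays for the
    left half and for \<open>g\<close>, and \<open>C * \<rho>\<close> for the right half.\<close>
  define C where "C = c / (1 - \<rho>)"
  have "C \<ge> 0" using c \<rho> by (simp add: C_def)
  have C: "c + C * \<rho> = C" using \<rho> by (simp add: C_def field_simps)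
  \<comment> \<open>a supersolution: the trivial bound on \<open>z\<close> to the left of \<open>N\<close>, and \<open>C * p\<close> to the right, where
    subexponentiality gives \<open>\<theta> * (p * (C * p)) \<le> \<rho> * (C * p)\<close> up to the contribution of the left half\<close>
  define v where "v n = (if n < N then D * exp (a * of_int n) else C * p n)" for n
  have left: "(\<lambda>j. p (n - j) * v j) summable_on {..<N}"
    and left_eq: "(\<Sum>\<^sub>\<infinity>j\<in>{..<N}. p (n - j) * v j) = L n" for n
  proof -
    have "(\<lambda>j. p (n - j) * (D * exp (a * of_int j))) summable_on {..<N}"
      by (rule summable_on_comparison_test[OF summable_on_cmult_right[OF exp_summable_on_lessThan[OF a]]])
        (use nonneg le_one D_nonneg in \<open>auto intro!: mult_left_le_one_le\<close>)
    then show "(\<lambda>j. p (n - j) * v j) summable_on {..<N}"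
      by (rule summable_on_cong[THEN iffD1, rotated]) (simp add: v_def)
    show "(\<Sum>\<^sub>\<infinity>j\<in>{..<N}. p (n - j) * v j) = L n"
      unfolding L_def by (rule infsum_cong) (simp add: v_def)
  qed
  have right: "(\<lambda>j. p (n - j) * v j) summable_on {N..}"
    and right_eq: "(\<Sum>\<^sub>\<infinity>j\<in>{N..}. p (n - j) * v j) = C * (\<Sum>\<^sub>\<infinity>j\<in>{N..}. p (n - j) * p j)" for n
  proof -
    show "(\<lambda>j. p (n - j) * v j) summable_on {N..}"
      using summable_on_cmult_right[OF summable_convolution, of C n "{N..}"]
      by (rule summable_on_cong[THEN iffD1, rotated]) (simp add: v_def)
    show "(\<Sum>\<^sub>\<infinity>j\<in>{N..}. p (n - j) * v j) = C * (\<Sum>\<^sub>\<infinity>j\<in>{N..}. p (n - j) * p j)"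
      unfolding infsum_cmult_right'[symmetric] by (rule infsum_cong) (simp add: v_def)
  qed
  have UNIV_split: "UNIV = {..<N} \<union> {N..}" by auto
  have "z n \<le> v n" for n
  proof (rule comparison)
    show "0 \<le> v n" for n using D_nonneg \<open>C \<ge> 0\<close> nonneg by (simp add: v_def)
    show "z n \<le> v n" if "n < N" for n using that z_le by (simp add: v_def)
    show "(\<lambda>j. p (n - j) * v j) summable_on UNIV" for n
      unfolding UNIV_split by (intro summable_on_union left right)
    show "\<theta> * (\<Sum>\<^sub>\<infinity>j. p (n - j) * v j) + g n \<le> v n" if "n \<ge> N" for n
    proof -
      have "(\<Sum>\<^sub>\<infinity>j. p (n - j) * v j) = L n + C * (\<Sum>\<^sub>\<infinity>j\<in>{N..}. p (n - j) * p j)"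
        unfolding UNIV_split by (subst infsum_Un_disjoint[OF left right]) (auto simp: left_eq right_eq)
      moreover have "\<theta> * (\<Sum>\<^sub>\<infinity>j\<in>{N..}. p (n - j) * p j) \<le> \<rho> * p n"
      proof -
        \<comment> \<open>\<open>N\<close> lies to the right of \<open>K\<close>, so the half-line
          starting at \<open>N\<close> carries less than the one for which \<open>\<rho>\<close> was
          chosen.\<close>
        have "(\<Sum>\<^sub>\<infinity>j\<in>{N..}. p (n - j) * p j) \<le> (\<Sum>\<^sub>\<infinity>j\<in>{K..}. p (n - j) * p j)"
          using N[of N] by (intro infsum_mono2 summable_convolution) (auto simp: nonneg)
        then have "\<theta> * (\<Sum>\<^sub>\<infinity>j\<in>{N..}. p (n - j) * p j) \<le> \<theta> * (\<Sum>\<^sub>\<infinity>j\<in>{K..}. p (n - j) * p j)"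
          using \<theta> by simp
        then show ?thesis using N[OF that] by linarith
      qed
      then have "C * (\<theta> * (\<Sum>\<^sub>\<infinity>j\<in>{N..}. p (n - j) * p j)) \<le> C * (\<rho> * p n)"
        using \<open>C \<ge> 0\<close> by (rule mult_left_mono)
      ultimately have "\<theta> * (\<Sum>\<^sub>\<infinity>j. p (n - j) * v j) + g n \<le> (\<theta> * L n + g n) + C * (\<rho> * p n)"
        by (simp add: algebra_simps)
      also have "\<dots> \<le> (c + C * \<rho>) * p n" using c(2)[OF that] by (simp add: algebra_simps)
      finally show ?thesis using that by (simp add: C v_def)
    qed
  qed
  then have "z n \<le> C * p n" if "n \<ge> N" for n
    using that by (metis v_def not_less)
  then show ?thesis using that[of C N] \<open>C \<ge> 0\<close> N by blast
qed

lemma summable_z: "z summable_on UNIV"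
proof -
  obtain C N where C: "\<And>n. n \<ge> N \<Longrightarrow> z n \<le> C * p n" by (rule bounded_by_masses) blast
  have "z summable_on {..<N}"
    by (rule summable_on_comparison_test[OF summable_on_cmult_right[OF exp_summable_on_lessThan[OF a]]])
      (use z_nonneg z_le in auto)
  moreover have "z summable_on {N..}"
    by (rule summable_on_comparison_test[OF summable_on_cmult_right[OF summable]])
      (use z_nonneg C in auto)
  moreover have "UNIV = {..<N} \<union> {N..}" by auto
  ultimately show ?thesis by (metis summable_on_union)
qed

text \<open>Of the convolution of \<open>p\<close> and \<open>z\<close> at a large \<open>n\<close>, the terms with small second index contribute
  about \<open>S * p n\<close>, those with small first index about \<open>z n\<close>, and the rest is negligible. Hence the
  candidate limit solves \<open>l = \<theta> * (S + l)\<close>, and the deviation from it shrinks by the factor \<open>\<theta>\<close>.\<close>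

lemma contraction:
  defines "S \<equiv> infsum z UNIV"
  defines "l \<equiv> \<theta> / (1 - \<theta>) * S"
  assumes c: "c \<ge> 0" "\<forall>\<^sub>F n in at_top. \<bar>z n - l * p n\<bar> \<le> c * p n" and "\<epsilon> > 0"
  shows "\<forall>\<^sub>F n in at_top. \<bar>z n - l * p n\<bar> \<le> (\<theta> * c + \<epsilon>) * p n"
proof -
  obtain C N where C: "C \<ge> 0" "\<And>n. n \<ge> N \<Longrightarrow> z n \<le> C * p n" by (rule bounded_by_masses) blast
  have "S \<ge> 0" unfolding S_def by (intro infsum_nonneg z_nonneg)
  then have "l \<ge> 0" using \<theta> by (simp add: l_def)
  have l_eq: "l = \<theta> * (S + l)" using \<theta> by (simp add: l_def field_simps)
  \<comment> \<open>The denominator collects the errors below: \<open>4 + c + l + C\<close>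
    multiples of \<open>\<delta>\<close> from the three ranges and one from \<open>g\<close>, with
    one to spare.\<close>
  define \<delta> where "\<delta> = \<epsilon> / (6 + c + l + C)"
  have "\<delta> > 0" using \<open>\<epsilon> > 0\<close> c C \<open>l \<ge> 0\<close> by (simp add: \<delta>_def)
  have \<delta>: "\<delta> * (6 + c + l + C) = \<epsilon>" using c C \<open>l \<ge> 0\<close> by (simp add: \<delta>_def)
  have zK: "((\<lambda>K. S - infsum z {..<K}) \<longlongrightarrow> S - S) at_top"
    unfolding S_def by (intro tendsto_intros infsum_partial_tendsto summable_z z_nonneg)
  have pK: "((\<lambda>K. infsum p {..<K}) \<longlongrightarrow> 1) at_top"
    using infsum_partial_tendsto[OF summable nonneg] infsumI[OF total] by simp
  have pK1: "((\<lambda>K. C * (2 - 2 * infsum p {..<K})) \<longlongrightarrow> C * (2 - 2 * 1)) at_top"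
    by (intro tendsto_intros pK)
  have pK2: "((\<lambda>K. l * (1 - infsum p {..<K})) \<longlongrightarrow> l * (1 - 1)) at_top"
    by (intro tendsto_intros pK)
  \<comment> \<open>\<open>K\<close> is fixed before \<open>n\<close>. It makes three remainders
    small: the part of \<open>S\<close> from \<open>K\<close> on, the middle range weighted by
    \<open>C\<close>, and the mass of \<open>p\<close> from \<open>K\<close> on weighted by
    \<open>l\<close>.\<close>
  have "\<forall>\<^sub>F K in at_top. N \<le> K \<and> S - infsum z {..<K} < \<delta> \<and> C * (2 - 2 * infsum p {..<K}) < \<delta>
      \<and> l * (1 - infsum p {..<K}) < \<delta>"
    using \<open>\<delta> > 0\<close>
    by (intro eventually_conj eventually_ge_at_top order_tendstoD(2)[OF zK]
        order_tendstoD(2)[OF pK1] order_tendstoD(2)[OF pK2]) auto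
  then obtain K where K: "N \<le> K" "S - infsum z {..<K} < \<delta>" "C * (2 - 2 * infsum p {..<K}) < \<delta>"
      "l * (1 - infsum p {..<K}) < \<delta>"
    by (auto dest: eventually_happens)
  define F where "F = infsum p {..<K}"
  have F: "F \<le> 1" unfolding F_def infsumI[OF total, symmetric]
    by (rule infsum_mono2[OF summable summable]) (auto simp: nonneg)
  have SK: "infsum z {..<K} \<le> S" unfolding S_def
    by (rule infsum_mono2[OF summable_on_subset[OF summable_z] summable_z]) (auto simp: z_nonneg)
  define L where "L n = (\<Sum>\<^sub>\<infinity>j\<in>{..<K}. p (n - j) * z j)" for n
  define Q where "Q n = (\<Sum>\<^sub>\<infinity>j\<in>{..<K}. p (n - j) * p j)" for n
  define R where "R n = (\<Sum>\<^sub>\<infinity>j\<in>{..<K}. p j * z (n - j))" for n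
  define m where "m n = (\<Sum>j=K..n-K. p (n - j) * p j)" for n
  define mz where "mz n = (\<Sum>j=K..n-K. p (n - j) * z j)" for n
  have "((\<lambda>n. L n / p n) \<longlongrightarrow> infsum z {..<K}) at_top"
    unfolding L_def using summable_on_subset[OF summable_z] z_nonneg
    by (intro left_tail_convolution) auto
  from tendstoD[OF this \<open>\<delta> > 0\<close>]
  have 1: "\<forall>\<^sub>F n in at_top. \<bar>L n / p n - infsum z {..<K}\<bar> < \<delta>" by (simp add: dist_real_def)
  have "((\<lambda>n. Q n / p n) \<longlongrightarrow> F) at_top"
    unfolding Q_def F_def using summable nonneg by (intro left_tail_convolution) auto
  from tendstoD[OF this \<open>\<delta> > 0\<close>]
  have 2: "\<forall>\<^sub>F n in at_top. \<bar>Q n / p n - F\<bar> < \<delta>" by (simp add: dist_real_def)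
  have "((\<lambda>n. m n / p n) \<longlongrightarrow> 2 - 2 * F) at_top"
    unfolding m_def F_def by (rule middle_convolution)
  from tendstoD[OF this \<open>\<delta> > 0\<close>]
  have 3: "\<forall>\<^sub>F n in at_top. \<bar>m n / p n - (2 - 2 * F)\<bar> < \<delta>" by (simp add: dist_real_def)
  have 4: "\<forall>\<^sub>F n in at_top. g n / p n < \<delta>"
    by (rule order_tendstoD(2)[OF g_negligible \<open>\<delta> > 0\<close>])
  obtain n1 where n1: "\<And>n. n \<ge> n1 \<Longrightarrow> \<bar>z n - l * p n\<bar> \<le> c * p n"
    using c(2) unfolding eventually_at_top_linorder by auto
  from 1 2 3 4 eventually_pos eventually_ge_at_top[of "2 * K"] eventually_ge_at_top[of "n1 + K"]
  show ?thesis
  proof eventually_elim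
    case (elim n)
    have pn: "0 < p n" by fact
    have "(\<Sum>\<^sub>\<infinity>j. p (n - j) * z j) = L n + R n + mz n"
      unfolding L_def R_def mz_def using elim by (intro convolution_split summable_convolution_z) auto
    then have zn: "z n = \<theta> * (L n + R n + mz n) + g n" using renewal[of n] by simp
    have R_summable: "(\<lambda>j. p j * z (n - j)) summable_on {..<K}"
    proof -
      have "(\<lambda>j. p (n - (n - j)) * z (n - j)) summable_on {..<K}"
        by (rule summable_on_reindex_bij_witness[THEN iffD1, OF _ _ _ _ _ summable_convolution_z[of n "{n-K<..}"],
            of "\<lambda>j. n - j" "\<lambda>j. n - j"]) auto
      then show ?thesis by simp
    qed
    have Q_sum: "((\<lambda>j. p (n - j) * p j) has_sum Q n) {..<K}"
      unfolding Q_def by (intro has_sum_infsum summable_convolution)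
    have "((\<lambda>j. p j * z (n - j)) has_sum R n) {..<K}"
      unfolding R_def by (intro has_sum_infsum R_summable)
    moreover have "p j * z (n - j) \<le> (c + l) * (p (n - j) * p j) \<and> (l - c) * (p (n - j) * p j) \<le> p j * z (n - j)"
      if "j < K" for j
    proof -
      \<comment> \<open>Since \<open>j < K\<close> and \<open>n \<ge> n1 + K\<close>, the index
        \<open>n - j\<close> is still beyond \<open>n1\<close>, so the assumed deviation bound is
        available there.\<close>
      have "z (n - j) \<le> (c + l) * p (n - j)" "(l - c) * p (n - j) \<le> z (n - j)"
        using n1[of "n - j"] that elim by (auto simp: algebra_simps abs_le_iff)
      from this[THEN mult_right_mono[OF _ nonneg[of j]]] show ?thesis by (simp add: mult_ac)
    qed
    ultimately have "R n \<le> (c + l) * Q n" "(l - c) * Q n \<le> R n"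
      using has_sum_mono[OF _ has_sum_cmult_right[OF Q_sum], of _ "R n" "c + l"]
        has_sum_mono[OF has_sum_cmult_right[OF Q_sum], of _ "R n" "l - c"] by auto
    then have R: "R n / p n \<le> (c + l) * (Q n / p n)" "(l - c) * (Q n / p n) \<le> R n / p n"
      using pn by (auto simp: divide_right_mono)
    have Qp: "Q n / p n \<le> 1 + \<delta>" using elim F by linarith
    have cQ: "c * (Q n / p n) \<le> c * (1 + \<delta>)" using c Qp by (intro mult_left_mono)
    \<comment> \<open>Comparing with 1 in place of the limit \<open>F\<close> costs
      \<open>1 - F\<close>, which by the choice of \<open>K\<close> is small even after
      multiplication by \<open>l\<close>.\<close>
    have "\<bar>Q n / p n - 1\<bar> \<le> \<delta> + (1 - F)" using elim F by linarith
    then have "l * \<bar>Q n / p n - 1\<bar> \<le> l * (\<delta> + (1 - F))" using \<open>l \<ge> 0\<close> by (rule mult_left_mono)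
    moreover have "\<bar>l * (Q n / p n) - l\<bar> = l * \<bar>Q n / p n - 1\<bar>"
      using \<open>l \<ge> 0\<close> abs_mult[of l "Q n / p n - 1"] by (simp add: right_diff_distrib)
    ultimately have "\<bar>l * (Q n / p n) - l\<bar> \<le> l * \<delta> + \<delta>"
      using K(4) by (simp add: F_def algebra_simps)
    then have R': "\<bar>R n / p n - l\<bar> \<le> c + c * \<delta> + l * \<delta> + \<delta>"
      using R cQ unfolding distrib_right left_diff_distrib distrib_left abs_le_iff by linarith
    have "mz n \<le> C * m n"
      unfolding mz_def m_def sum_distrib_left
    proof (rule sum_mono)
      fix j assume "j \<in> {K..n-K}"
      then have "z j \<le> C * p j" using K(1) by (intro C) auto
      from mult_left_mono[OF this nonneg[of "n - j"]]
      show "p (n - j) * z j \<le> C * (p (n - j) * p j)" by (simp add: mult_ac)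
    qed
    then have "mz n / p n \<le> C * (m n / p n)" using pn by (simp add: divide_right_mono)
    also have "\<dots> \<le> C * (2 - 2 * F + \<delta>)"
      using elim C(1) by (intro mult_left_mono) linarith+
    finally have mz: "mz n / p n \<le> \<delta> + C * \<delta>" using K(3) by (simp add: F_def algebra_simps)
    have mz0: "mz n / p n \<ge> 0"
      unfolding mz_def by (intro divide_nonneg_nonneg sum_nonneg mult_nonneg_nonneg nonneg z_nonneg)
    have g0: "g n / p n \<ge> 0" by (simp add: g_nonneg nonneg)
    have L: "\<bar>L n / p n - S\<bar> \<le> 2 * \<delta>" using elim K(2) SK by linarith
    \<comment> \<open>The deviations of the three ranges from their targets \<open>S\<close>,
      \<open>l\<close> and 0. As \<open>l = \<theta> * (S + l)\<close>, the renewal equation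
      expresses the deviation of \<open>z n / p n\<close> from \<open>l\<close> as
      \<open>\<theta> * E\<close> plus the term of \<open>g\<close>.\<close>
    define E where "E = (L n / p n - S) + (R n / p n - l) + mz n / p n"
    have "\<bar>E\<bar> \<le> 2 * \<delta> + (c + c * \<delta> + l * \<delta> + \<delta>) + (\<delta> + C * \<delta>)"
      unfolding E_def using L R' mz mz0 by linarith
    then have "\<theta> * \<bar>E\<bar> \<le> \<theta> * (c + \<delta> * (4 + c + l + C))"
      using \<theta> by (intro mult_left_mono) (auto simp: algebra_simps)
    also have "\<dots> \<le> \<theta> * c + \<delta> * (4 + c + l + C)"
      unfolding distrib_left[of \<theta> c] using \<theta> \<open>\<delta> > 0\<close> c C \<open>l \<ge> 0\<close>
      by (intro add_left_mono mult_left_le_one_le mult_nonneg_nonneg) auto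
    finally have E: "\<theta> * \<bar>E\<bar> \<le> \<theta> * c + \<delta> * (4 + c + l + C)" .
    have "z n / p n - l = \<theta> * E + g n / p n"
    proof -
      have "z n / p n = \<theta> * (L n / p n + R n / p n + mz n / p n) + g n / p n"
        unfolding zn by (simp add: add_divide_distrib distrib_left)
      then show ?thesis using l_eq unfolding E_def by (simp add: algebra_simps)
    qed
    then have "\<bar>z n / p n - l\<bar> \<le> \<theta> * \<bar>E\<bar> + \<delta>"
      using elim g0 \<theta> abs_triangle_ineq[of "\<theta> * E" "g n / p n"] by (simp add: abs_mult)
    also have "\<dots> \<le> \<theta> * c + \<delta> * (6 + c + l + C)"
      using E \<open>\<delta> > 0\<close> by (simp add: algebra_simps)
    finally have "\<bar>z n / p n - l\<bar> \<le> \<theta> * c + \<epsilon>" unfolding \<delta> .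
    moreover have "\<bar>z n - l * p n\<bar> = \<bar>z n / p n - l\<bar> * p n"
      using pn abs_mult[of "z n / p n - l" "p n"] by (simp add: left_diff_distrib)
    ultimately show ?case using pn by (simp add: mult_right_mono)
  qed
qed

text \<open>The crude bound \<open>C + l\<close> on the deviation starts an iteration of
  \<open>contraction\<close>. The number \<open>m\<close> of iterations is fixed before
  \<open>n\<close>, since each of them holds only eventually.\<close>

theorem renewal_limit: "((\<lambda>n. z n / p n) \<longlongrightarrow> \<theta> / (1 - \<theta>) * infsum z UNIV) at_top"
proof (rule tendstoI)
  fix e :: real assume "e > 0"
  define l where "l = \<theta> / (1 - \<theta>) * infsum z UNIV"
  have "infsum z UNIV \<ge> 0" by (intro infsum_nonneg z_nonneg)
  then have "l \<ge> 0" using \<theta> by (simp add: l_def)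
  obtain C N where C: "C \<ge> 0" "\<And>n. n \<ge> N \<Longrightarrow> z n \<le> C * p n" by (rule bounded_by_masses) blast
  define \<epsilon> where "\<epsilon> = e / 3"
  have "\<epsilon> > 0" using \<open>e > 0\<close> by (simp add: \<epsilon>_def)
  have iter: "\<forall>\<^sub>F n in at_top. \<bar>z n - l * p n\<bar> \<le> (\<theta> ^ m * (C + l) + \<epsilon>) * p n" for m
  proof (induction m)
    case 0
    show ?case using eventually_ge_at_top[of N]
    proof eventually_elim
      case (elim n)
      have "\<bar>z n - l * p n\<bar> \<le> z n + l * p n"
        using z_nonneg[of n] \<open>l \<ge> 0\<close> nonneg[of n] by (auto simp: abs_le_iff)
      also have "\<dots> \<le> (C + l) * p n + \<epsilon> * p n"
        using C(2)[OF elim] mult_nonneg_nonneg[OF less_imp_le[OF \<open>\<epsilon> > 0\<close>] nonneg[of n]]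
        by (simp add: algebra_simps)
      finally show ?case by (simp add: algebra_simps)
    qed
  next
    case (Suc m)
    \<comment> \<open>With slack \<open>(1 - \<theta>) * \<epsilon>\<close> the additive error
      reproduces itself: \<open>\<theta> * \<epsilon> + (1 - \<theta>) * \<epsilon> =
      \<epsilon>\<close>.\<close>
    have "\<theta> ^ m * (C + l) + \<epsilon> \<ge> 0" "(1 - \<theta>) * \<epsilon> > 0"
      using \<theta> C \<open>l \<ge> 0\<close> \<open>\<epsilon> > 0\<close> by auto
    from contraction[folded l_def, OF this(1) Suc this(2)]
    show ?case by (simp add: algebra_simps)
  qed
  have "(\<lambda>m. \<theta> ^ m * (C + l)) \<longlonglongrightarrow> 0 * (C + l)"
    using \<theta> by (intro tendsto_intros LIMSEQ_realpow_zero) auto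
  then have "\<forall>\<^sub>F m in sequentially. \<theta> ^ m * (C + l) < \<epsilon>"
    using \<open>\<epsilon> > 0\<close> by (intro order_tendstoD(2)[where y = "0 * (C + l)"]) auto
  then obtain m where m: "\<theta> ^ m * (C + l) < \<epsilon>" by (auto dest: eventually_happens)
  from iter[of m] eventually_pos
  show "\<forall>\<^sub>F n in at_top. dist (z n / p n) (\<theta> / (1 - \<theta>) * infsum z UNIV) < e"
  proof eventually_elim
    case (elim n)
    have "\<bar>z n / p n - l\<bar> * p n = \<bar>z n - l * p n\<bar>"
      using elim abs_mult[of "z n / p n - l" "p n"] by (simp add: left_diff_distrib)
    also have "\<dots> \<le> (\<theta> ^ m * (C + l) + \<epsilon>) * p n" using elim by simp
    finally have "\<bar>z n / p n - l\<bar> \<le> \<theta> ^ m * (C + l) + \<epsilon>" using elim by simp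
    then show ?case using m \<open>\<epsilon> > 0\<close> unfolding dist_real_def l_def[symmetric] by (simp add: \<epsilon>_def)
  qed
qed

end

section \<open>Lattice distributions and the tilted law\<close>

lemma (in real_distribution) jump_cdf: "jump (cdf M) x = measure M {x}"
proof -
  have "Lim (at_left x) (cdf M) = measure M {..<x}"
    by (intro tendsto_Lim cdf_at_left) simp
  moreover have "measure M {..x} = measure M {..<x} + measure M {x}"
    unfolding ivl_disj_un(2)[symmetric] by (subst finite_measure_Union) auto
  ultimately show ?thesis by (simp add: jump_def cdf_def)
qed

text \<open>Almost everywhere \<open>f y\<close> is a sum over \<open>k\<close> in which only the
  \<open>k\<close> with \<open>k * h = y\<close> contributes, unique because \<open>h > 0\<close>.
  Exchanging sum and integral gives the claim.\<close>

lemma nn_integral_lattice: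
  assumes sets: "sets \<mu> = sets borel" and h: "h > 0"
    and ae: "AE y in \<mu>. y \<in> integer_multiples h"
    and f[measurable]: "f \<in> borel_measurable borel"
  shows "(\<integral>\<^sup>+y. f y \<partial>\<mu>) = (\<integral>\<^sup>+k. f (of_int k * h) * emeasure \<mu> {of_int k * h} \<partial>count_space UNIV)"
proof -
  note sets[measurable_cong]
  have "(\<integral>\<^sup>+y. f y \<partial>\<mu>)
      = (\<integral>\<^sup>+y. \<integral>\<^sup>+k. f (of_int k * h) * indicator {of_int k * h} y \<partial>count_space UNIV \<partial>\<mu>)"
  proof (rule nn_integral_cong_AE, use ae in eventually_elim)
    case (elim y)
    then obtain m :: int where m: "y = of_int m * h" by (auto simp: integer_multiples_def)
    have "(\<integral>\<^sup>+k. f (of_int k * h) * indicator {of_int k * h} y \<partial>count_space UNIV)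
        = (\<integral>\<^sup>+k. f (of_int k * h) * indicator {m} k \<partial>count_space UNIV)"
      using h by (intro nn_integral_cong) (auto simp: m indicator_def)
    also have "\<dots> = f y" by (subst nn_integral_indicator_singleton) (auto simp: m)
    finally show ?case ..
  qed
  also have "\<dots> = (\<integral>\<^sup>+k. \<integral>\<^sup>+y. f (of_int k * h) * indicator {of_int k * h} y \<partial>\<mu> \<partial>count_space UNIV)"
    by (rule nn_integral_count_space_nn_integral) auto
  also have "\<dots> = (\<integral>\<^sup>+k. f (of_int k * h) * emeasure \<mu> {of_int k * h} \<partial>count_space UNIV)"
    by (intro nn_integral_cong nn_integral_cmult_indicator) (simp add: sets)
  finally show ?thesis .
qed

lemma has_sum_nn_integral_count_space:
  fixes f :: "'a \<Rightarrow> real"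
  assumes "\<And>k. 0 \<le> f k" and "(\<integral>\<^sup>+k. ennreal (f k) \<partial>count_space UNIV) = ennreal s" and "0 \<le> s"
  shows "(f has_sum s) UNIV"
proof -
  have int: "integrable (count_space UNIV) f" "integral\<^sup>L (count_space UNIV) f = s"
    using integrableI_nn_integral_finite[of f "count_space UNIV" s]
      integral_eq_nn_integral[of f "count_space UNIV"] assms by auto
  have summable: "Infinite_Set_Sum.abs_summable_on f UNIV"
    unfolding Infinite_Set_Sum.abs_summable_on_def by (intro int(1))
  have "f summable_on UNIV"
    by (rule abs_summable_summable[OF abs_summable_equivalent[THEN iffD2, OF summable]])
  moreover have "infsum f UNIV = s"
    using int(2) infsetsum_infsum[OF summable] by (simp add: infsetsum_def)
  ultimately show ?thesis by (simp add: has_sum_iff)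
qed

lemma (in real_distribution) has_sum_lattice:
  assumes h: "h > 0" and ae: "AE y in M. y \<in> integer_multiples h"
    and f[measurable]: "f \<in> borel_measurable borel" and nonneg: "\<And>y. 0 \<le> f y"
    and s: "(\<integral>\<^sup>+y. ennreal (f y) \<partial>M) = ennreal s" "0 \<le> s"
  shows "((\<lambda>k. measure M {of_int k * h} * f (of_int k * h)) has_sum s) UNIV"
proof (rule has_sum_nn_integral_count_space)
  have "(\<integral>\<^sup>+k. ennreal (measure M {of_int k * h} * f (of_int k * h)) \<partial>count_space UNIV)
     = (\<integral>\<^sup>+k. ennreal (f (of_int k * h)) * emeasure M {of_int k * h} \<partial>count_space UNIV)"
    using nonneg by (intro nn_integral_cong) (simp add: emeasure_eq_measure ennreal_mult mult.commute)
  also have "\<dots> = ennreal s"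
    using nn_integral_lattice[OF events_eq_borel h ae, of "\<lambda>y. ennreal (f y)"] s by simp
  finally show "(\<integral>\<^sup>+k. ennreal (measure M {of_int k * h} * f (of_int k * h)) \<partial>count_space UNIV)
     = ennreal s" .
qed (use nonneg s in auto)

lemma (in real_distribution) lattice_mass_cdf: "lattice_mass h (cdf M) k = measure M {of_int k * h}"
  by (simp add: lattice_mass_def jump_cdf)

lemma (in real_distribution) lattice_mass_convolution:
  assumes h: "h > 0" and ae: "AE y in M. y \<in> integer_multiples h"
  shows "lattice_mass h (cdf (M \<star> M)) n
    = (\<Sum>\<^sub>\<infinity>j. lattice_mass h (cdf M) (n - j) * lattice_mass h (cdf M) j)"
proof -
  interpret P: pair_prob_space M M ..
  interpret C: real_distribution "M \<star> M"
    unfolding convolution_def by (rule P.real_distribution_distr) simp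
  \<comment> \<open>A point mass is the difference of the masses of a closed and an open half-line,
    both monotone in the endpoint; this yields measurability.\<close>
  have meas: "(\<lambda>x. measure M {of_int n * h - x}) \<in> borel_measurable borel"
  proof -
    have "(\<lambda>x. measure M {..of_int n * h - x} - measure M {..<of_int n * h - x}) \<in> borel_measurable borel"
    proof (rule borel_measurable_diff)
      have "mono (\<lambda>x. - measure M {..of_int n * h - x})" "mono (\<lambda>x. - measure M {..<of_int n * h - x})"
        by (auto simp: mono_def intro!: finite_measure_mono)
      from this[THEN borel_measurable_mono, THEN borel_measurable_uminus]
      show "(\<lambda>x. measure M {..of_int n * h - x}) \<in> borel_measurable borel"
        "(\<lambda>x. measure M {..<of_int n * h - x}) \<in> borel_measurable borel" by simp_all
    qed
    moreover have "measure M {..y} - measure M {..<y} = measure M {y}" for y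
      unfolding ivl_disj_un(2)[symmetric] by (subst finite_measure_Union) auto
    ultimately show ?thesis by simp
  qed
  have "emeasure (M \<star> M) {of_int n * h} = (\<integral>\<^sup>+x. emeasure M {a. a + x \<in> {of_int n * h}} \<partial>M)"
    by (intro convolution_emeasure) (auto simp: finite_measure_axioms)
  also have "\<dots> = (\<integral>\<^sup>+x. ennreal (measure M {of_int n * h - x}) \<partial>M)"
    by (intro nn_integral_cong) (auto simp: emeasure_eq_measure algebra_simps intro!: arg_cong[where f = "measure M"])
  finally have "((\<lambda>k. measure M {of_int k * h} * measure M {of_int n * h - of_int k * h}) has_sum
      measure (M \<star> M) {of_int n * h}) UNIV"
    by (intro has_sum_lattice[OF h ae meas]) (auto simp: C.emeasure_eq_measure)
  from infsumI[OF this, symmetric] show ?thesis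
    unfolding C.lattice_mass_cdf unfolding lattice_mass_cdf
    by (rule trans) (rule infsum_cong, simp add: left_diff_distrib)
qed

text \<open>The law with distribution function \<open>tilted_cdf\<close>, see
  \<open>cdf_tilted_law\<close>. The density vanishes where \<open>A\<close> does, so the value of
  \<open>ln 0\<close> has no influence.\<close>

definition tilted_law :: "'a measure \<Rightarrow> ('a \<Rightarrow> real) \<Rightarrow> real \<Rightarrow> real measure" where
  "tilted_law M A \<kappa> =
     distr (density M (\<lambda>\<omega>. ennreal (A \<omega> powr \<kappa> / (\<integral>\<omega>. A \<omega> powr \<kappa> \<partial>M)))) borel (\<lambda>\<omega>. ln (A \<omega>))"

section \<open>The exponential change of measure\<close>

context
  fixes M :: "'a measure" and A :: "'a \<Rightarrow> real" and \<kappa> \<theta> :: real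
  assumes A[measurable]: "A \<in> borel_measurable M"
    and int: "integrable M (\<lambda>\<omega>. A \<omega> powr \<kappa>)" and \<theta>: "(\<integral>\<omega>. A \<omega> powr \<kappa> \<partial>M) = \<theta>" "0 < \<theta>"
begin

lemma nn_integral_tilted_law:
  assumes [measurable]: "f \<in> borel_measurable borel"
  shows "(\<integral>\<^sup>+y. f y \<partial>tilted_law M A \<kappa>) = (\<integral>\<^sup>+\<omega>. ennreal (A \<omega> powr \<kappa> / \<theta>) * f (ln (A \<omega>)) \<partial>M)"
  unfolding tilted_law_def \<theta> by (simp add: nn_integral_distr nn_integral_density)

lemma real_distribution_tilted_law: "real_distribution (tilted_law M A \<kappa>)"
proof (intro real_distribution.intro prob_spaceI real_distribution_axioms.intro)
  have "emeasure (tilted_law M A \<kappa>) (space (tilted_law M A \<kappa>)) = (\<integral>\<^sup>+\<omega>. ennreal (A \<omega> powr \<kappa> / \<theta>) \<partial>M)"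
    using nn_integral_tilted_law[of "\<lambda>_. 1"] by simp
  also have "\<dots> = ennreal (\<integral>\<omega>. A \<omega> powr \<kappa> / \<theta> \<partial>M)"
    using int \<theta> by (intro nn_integral_eq_integral) auto
  also have "\<dots> = 1" using \<theta> by simp
  finally show "emeasure (tilted_law M A \<kappa>) (space (tilted_law M A \<kappa>)) = 1" .
qed (simp add: tilted_law_def)

lemma cdf_tilted_law: "cdf (tilted_law M A \<kappa>) = tilted_cdf M A \<kappa>"
proof
  fix x
  interpret T: real_distribution "tilted_law M A \<kappa>" by (rule real_distribution_tilted_law)
  have "integrable M (\<lambda>\<omega>. indicator {\<omega>. ln (A \<omega>) \<le> x} \<omega> * A \<omega> powr \<kappa>)"
    by (rule Bochner_Integration.integrable_bound[OF int]) (auto simp: indicator_def)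
  then have "integrable M (\<lambda>\<omega>. indicator {\<omega>. ln (A \<omega>) \<le> x} \<omega> * A \<omega> powr \<kappa> / \<theta>)"
    by (rule integrable_divide)
  moreover have "(\<lambda>\<omega>. indicator {\<omega>. ln (A \<omega>) \<le> x} \<omega> * A \<omega> powr \<kappa> / \<theta>)
      = (\<lambda>\<omega>. A \<omega> powr \<kappa> / \<theta> * indicator {..x} (ln (A \<omega>)))"
    by (auto simp: indicator_def)
  ultimately have i: "integrable M (\<lambda>\<omega>. A \<omega> powr \<kappa> / \<theta> * indicator {..x} (ln (A \<omega>)))"
    by simp
  have "emeasure (tilted_law M A \<kappa>) {..x} = (\<integral>\<^sup>+y. indicator {..x} y \<partial>tilted_law M A \<kappa>)"
    by (simp add: tilted_law_def)
  also have "\<dots> = (\<integral>\<^sup>+\<omega>. ennreal (A \<omega> powr \<kappa> / \<theta> * indicator {..x} (ln (A \<omega>))) \<partial>M)"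
    using \<theta> by (subst nn_integral_tilted_law) (auto intro!: nn_integral_cong simp: indicator_def)
  also have "\<dots> = ennreal (\<integral>\<omega>. A \<omega> powr \<kappa> / \<theta> * indicator {..x} (ln (A \<omega>)) \<partial>M)"
    using \<theta> by (intro nn_integral_eq_integral i) auto
  finally have "measure (tilted_law M A \<kappa>) {..x} = (\<integral>\<omega>. A \<omega> powr \<kappa> / \<theta> * indicator {..x} (ln (A \<omega>)) \<partial>M)"
    using \<theta> by (simp add: T.emeasure_eq_measure integral_nonneg_AE)
  also have "\<dots> = (\<integral>\<omega>. inverse \<theta> * (indicator {\<omega>. ln (A \<omega>) \<le> x} \<omega> * A \<omega> powr \<kappa>) \<partial>M)"
    by (intro Bochner_Integration.integral_cong) (auto simp: indicator_def field_simps)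
  finally show "cdf (tilted_law M A \<kappa>) x = tilted_cdf M A \<kappa> x"
    by (simp add: cdf_def tilted_cdf_def \<theta>)
qed

text \<open>The integrand undoes the tilt and leaves the original probability of the event on which
  the density is positive. This is the source of \<open>mgf_le\<close>.\<close>

lemma nn_integral_tilted_exp:
  assumes "prob_space M" and pos: "AE \<omega> in M. A \<omega> \<ge> 0"
  shows "(\<integral>\<^sup>+y. ennreal (exp (- \<kappa> * y)) \<partial>tilted_law M A \<kappa>) = ennreal (\<P>(\<omega> in M. A \<omega> \<noteq> 0) / \<theta>)"
proof -
  interpret M: prob_space M by fact
  have "(\<integral>\<^sup>+y. ennreal (exp (- \<kappa> * y)) \<partial>tilted_law M A \<kappa>)
      = (\<integral>\<^sup>+\<omega>. ennreal (A \<omega> powr \<kappa> / \<theta>) * ennreal (exp (- \<kappa> * ln (A \<omega>))) \<partial>M)"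
    by (rule nn_integral_tilted_law) measurable
  also have "\<dots> = (\<integral>\<^sup>+\<omega>. ennreal (1 / \<theta>) * indicator {\<omega> \<in> space M. A \<omega> \<noteq> 0} \<omega> \<partial>M)"
  proof (rule nn_integral_cong_AE, use pos AE_space in eventually_elim)
    case (elim \<omega>)
    show ?case
    proof (cases "A \<omega> = 0")
      case False
      then have "A \<omega> powr \<kappa> * exp (- (\<kappa> * ln (A \<omega>))) = 1"
        using elim by (simp add: powr_def flip: exp_add)
      then show ?thesis using elim \<theta> False by (simp flip: ennreal_mult)
    qed simp
  qed
  also have "\<dots> = ennreal (1 / \<theta>) * emeasure M {\<omega> \<in> space M. A \<omega> \<noteq> 0}"
    by (rule nn_integral_cmult_indicator) measurable
  also have "\<dots> = ennreal (\<P>(\<omega> in M. A \<omega> \<noteq> 0) / \<theta>)"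
    using \<theta> by (simp add: M.emeasure_eq_measure flip: ennreal_mult)
  finally show ?thesis .
qed

text \<open>Fubini, integrating over \<open>X\<close> first. If \<open>A > 0\<close>, then
  \<open>A * X > t\<close> means that \<open>X\<close> exceeds \<open>t * exp (- ln A)\<close>; if
  \<open>A = 0\<close>, the event is empty because \<open>t > 0\<close>. The exponential factor
  cancels the density of the tilted law.\<close>

lemma prob_scaled_eq_tilted:
  assumes N: "prob_space N" "X \<in> borel_measurable N"
    and "prob_space M" and pos: "AE \<omega> in M. A \<omega> \<ge> 0" and t: "t > 0"
  shows "(\<integral>\<^sup>+y. ennreal (exp (- \<kappa> * y) * \<P>(\<omega>' in N. X \<omega>' > t * exp (- y))) \<partial>tilted_law M A \<kappa>)
    = ennreal (\<P>(\<omega> in M \<Otimes>\<^sub>M N. A (fst \<omega>) * X (snd \<omega>) > t) / \<theta>)"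
proof -
  interpret M: prob_space M by fact
  interpret N: prob_space N by fact
  interpret P: pair_prob_space M N ..
  note N(2)[measurable]
  have T: "(\<lambda>t. \<P>(\<omega>' in N. X \<omega>' > t)) \<in> borel_measurable borel"
  proof -
    have "mono (\<lambda>t. - \<P>(\<omega>' in N. X \<omega>' > t))"
      by (auto simp: mono_def intro!: N.finite_measure_mono)
    from borel_measurable_uminus[OF borel_measurable_mono[OF this]] show ?thesis by simp
  qed
  have "emeasure (M \<Otimes>\<^sub>M N) {\<omega> \<in> space (M \<Otimes>\<^sub>M N). A (fst \<omega>) * X (snd \<omega>) > t}
      = (\<integral>\<^sup>+\<omega>. emeasure N (Pair \<omega> -` {\<omega> \<in> space (M \<Otimes>\<^sub>M N). A (fst \<omega>) * X (snd \<omega>) > t}) \<partial>M)"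
    by (intro N.emeasure_pair_measure_alt) measurable
  also have "\<dots> = (\<integral>\<^sup>+\<omega>. ennreal (A \<omega> powr \<kappa>) *
      ennreal (exp (- \<kappa> * ln (A \<omega>)) * \<P>(\<omega>' in N. X \<omega>' > t * exp (- ln (A \<omega>)))) \<partial>M)"
  proof (rule nn_integral_cong_AE, use pos AE_space in eventually_elim)
    case (elim \<omega>)
    have "Pair \<omega> -` {\<omega> \<in> space (M \<Otimes>\<^sub>M N). A (fst \<omega>) * X (snd \<omega>) > t}
        = {\<omega>' \<in> space N. A \<omega> * X \<omega>' > t}"
      using elim by (auto simp: space_pair_measure)
    also have "emeasure N \<dots> = ennreal (A \<omega> powr \<kappa>) *
      ennreal (exp (- \<kappa> * ln (A \<omega>)) * \<P>(\<omega>' in N. X \<omega>' > t * exp (- ln (A \<omega>))))"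
    proof (cases "A \<omega> = 0")
      case True
      then show ?thesis using t by simp
    next
      case False
      then have "A \<omega> > 0" using elim by simp
      then have "A \<omega> powr \<kappa> * exp (- \<kappa> * ln (A \<omega>)) = 1"
        by (simp add: powr_def flip: exp_add)
      moreover have "{\<omega>' \<in> space N. A \<omega> * X \<omega>' > t} = {\<omega>' \<in> space N. X \<omega>' > t * exp (- ln (A \<omega>))}"
        using \<open>A \<omega> > 0\<close> by (auto simp: exp_minus field_simps)
      ultimately show ?thesis
        by (simp add: N.emeasure_eq_measure flip: ennreal_mult mult.assoc)
    qed
    finally show ?case .
  qed
  finally have *: "ennreal (\<P>(\<omega> in M \<Otimes>\<^sub>M N. A (fst \<omega>) * X (snd \<omega>) > t))
    = (\<integral>\<^sup>+\<omega>. ennreal (A \<omega> powr \<kappa>) *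
      ennreal (exp (- \<kappa> * ln (A \<omega>)) * \<P>(\<omega>' in N. X \<omega>' > t * exp (- ln (A \<omega>)))) \<partial>M)"
    by (simp add: P.emeasure_eq_measure)
  have [measurable]: "(\<lambda>y. exp (- \<kappa> * y) * \<P>(\<omega>' in N. X \<omega>' > t * exp (- y))) \<in> borel_measurable borel"
    by (intro borel_measurable_times measurable_compose[OF _ T]) measurable
  have "(\<integral>\<^sup>+y. ennreal (exp (- \<kappa> * y) * \<P>(\<omega>' in N. X \<omega>' > t * exp (- y))) \<partial>tilted_law M A \<kappa>)
    = (\<integral>\<^sup>+\<omega>. ennreal (1 / \<theta>) * (ennreal (A \<omega> powr \<kappa>) *
      ennreal (exp (- \<kappa> * ln (A \<omega>)) * \<P>(\<omega>' in N. X \<omega>' > t * exp (- ln (A \<omega>))))) \<partial>M)"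
    using \<theta> by (subst nn_integral_tilted_law)
      (auto intro!: nn_integral_cong simp: mult_ac simp flip: ennreal_mult)
  also have "\<dots> = ennreal (1 / \<theta>) * ennreal (\<P>(\<omega> in M \<Otimes>\<^sub>M N. A (fst \<omega>) * X (snd \<omega>) > t))"
    unfolding * by (intro nn_integral_cmult) (use measurable_compose[OF _ T] in measurable)
  also have "\<dots> = ennreal (\<P>(\<omega> in M \<Otimes>\<^sub>M N. A (fst \<omega>) * X (snd \<omega>) > t) / \<theta>)"
    using \<theta> by (simp flip: ennreal_mult)
  finally show ?thesis .
qed

end

section \<open>The maximum equation\<close>

lemma prob_gt_le_moment:
  fixes B :: "'a \<Rightarrow> real"
  assumes "prob_space M" and B[measurable]: "B \<in> borel_measurable M"
    and int: "integrable M (\<lambda>\<omega>. \<bar>B \<omega>\<bar> powr \<nu>)" and "\<nu> > 0" and t: "t > 0"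
  shows "\<P>(\<omega> in M. B \<omega> > t) \<le> (\<integral>\<omega>. \<bar>B \<omega>\<bar> powr \<nu> \<partial>M) * t powr (- \<nu>)"
proof -
  interpret prob_space M by fact
  have "\<P>(\<omega> in M. B \<omega> > t) \<le> \<P>(\<omega> in M. \<bar>B \<omega>\<bar> powr \<nu> \<ge> t powr \<nu>)"
    using t \<open>\<nu> > 0\<close> by (intro finite_measure_mono) (auto intro!: powr_mono2)
  also have "\<dots> \<le> (\<integral>\<omega>. \<bar>B \<omega>\<bar> powr \<nu> \<partial>M) / t powr \<nu>"
    using t by (intro integral_Markov_inequality_measure[OF int]) auto
  finally show ?thesis by (simp add: powr_minus field_simps)
qed

lemma prob_gt_tendsto_0:
  fixes X :: "'a \<Rightarrow> real"
  assumes "prob_space N" and [measurable]: "X \<in> borel_measurable N"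
  shows "((\<lambda>t. \<P>(\<omega> in N. X \<omega> > t)) \<longlongrightarrow> 0) at_top"
proof -
  interpret prob_space N by fact
  interpret D: real_distribution "distr N borel X" by (rule real_distribution_distr) simp
  have "\<P>(\<omega> in N. X \<omega> > t) = 1 - cdf (distr N borel X) t" for t
  proof -
    have "\<P>(\<omega> in N. X \<omega> > t) = \<P>(\<omega> in N. \<not> X \<omega> \<le> t)" by (simp add: not_le)
    also have "\<dots> = 1 - \<P>(\<omega> in N. X \<omega> \<le> t)" by (rule prob_neg) simp
    finally show ?thesis
      by (simp add: cdf_def measure_distr vimage_def Int_def conj_commute)
  qed
  then show ?thesis
    using tendsto_diff[OF tendsto_const D.cdf_lim_at_top_prob, of 1] by simp
qed

lemma subexponential_masses_of_cdf:
  assumes mem: "H \<in> h_subexponential h"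
    and O: "(\<lambda>n. SUP k\<in>{n..}. lattice_mass h H k) \<in> O[at_top](lattice_mass h H)"
  shows "subexponential_masses (lattice_mass h H)"
proof -
  obtain \<mu> where \<mu>: "real_distribution \<mu>" and H: "H = cdf \<mu>" and arith: "arithmetic_with_span \<mu> h"
    and ratio: "((\<lambda>n. lattice_mass h H (n + 1) / lattice_mass h H n) \<longlongrightarrow> 1) at_top"
    and square: "((\<lambda>n. lattice_mass h (cdf (\<mu> \<star> \<mu>)) n / lattice_mass h H n) \<longlongrightarrow> 2) at_top"
    using mem unfolding h_subexponential_def by auto
  interpret real_distribution \<mu> by fact
  have h: "h > 0" and ae: "AE y in \<mu>. y \<in> integer_multiples h"
    using arith by (auto simp: arithmetic_with_span_def)
  show ?thesis
  proof
    show "0 \<le> lattice_mass h H n" for n by (simp add: H lattice_mass_cdf)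
    show "(lattice_mass h H has_sum 1) UNIV"
      using has_sum_lattice[OF h ae, of "\<lambda>_. 1" 1] emeasure_space_1
      by (simp add: H lattice_mass_cdf[abs_def])
    show "((\<lambda>n. lattice_mass h H (n + 1) / lattice_mass h H n) \<longlongrightarrow> 1) at_top" by (rule ratio)
    show "((\<lambda>n. (\<Sum>\<^sub>\<infinity>j. lattice_mass h H (n - j) * lattice_mass h H j) / lattice_mass h H n)
        \<longlongrightarrow> 2) at_top"
      using square unfolding lattice_mass_convolution[OF h ae] H .
    obtain c where "\<forall>\<^sub>F n in at_top.
        norm (SUP k\<in>{n..}. lattice_mass h H k) \<le> c * norm (lattice_mass h H n)"
      using landau_o.bigE[OF O] by blast
    then have "\<forall>\<^sub>F n in at_top. \<forall>k\<ge>n. lattice_mass h H k \<le> c * lattice_mass h H n"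
    proof eventually_elim
      case (elim n)
      show ?case
      proof (intro allI impI)
        fix k assume "n \<le> k"
        \<comment> \<open>The masses are probabilities, so the set is bounded above and the supremum
          is a genuine upper bound.\<close>
        then have "lattice_mass h H k \<le> (SUP k\<in>{n..}. lattice_mass h H k)"
          by (intro cSUP_upper bdd_aboveI[of _ 1]) (auto simp: H lattice_mass_cdf)
        then show "lattice_mass h H k \<le> c * lattice_mass h H n"
          using elim by (simp add: H lattice_mass_cdf)
      qed
    qed
    then show "\<exists>c. \<forall>\<^sub>F n in at_top. \<forall>k\<ge>n. lattice_mass h H k \<le> c * lattice_mass h H n" ..
  qed
qed

section \<open>From the maximum equation to the renewal equation\<close>

context
  fixes M :: "'a measure" and N :: "'b measure"
    and A B :: "'a \<Rightarrow> real" and X :: "'b \<Rightarrow> real" and \<kappa> \<theta> :: real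
  assumes M: "prob_space M"
    and A[measurable]: "A \<in> borel_measurable M" and B[measurable]: "B \<in> borel_measurable M"
    and sol: "max_equation_solution M A B N X"
begin

text \<open>The event that the maximum exceeds \<open>t\<close> is split into disjoint pieces. The
  first becomes the convolution term of the renewal equation and the second its
  inhomogeneity.\<close>

lemma tail_decomposition:
  "\<P>(\<omega> in N. X \<omega> > t) = \<P>(\<omega> in M \<Otimes>\<^sub>M N. A (fst \<omega>) * X (snd \<omega>) > t)
     + \<P>(\<omega> in M \<Otimes>\<^sub>M N. B (fst \<omega>) > t \<and> A (fst \<omega>) * X (snd \<omega>) \<le> t)"
proof -
  interpret M: prob_space M by (rule M)
  have N: "prob_space N" and X[measurable]: "X \<in> borel_measurable N"
    and eq: "distr N borel X = distr (M \<Otimes>\<^sub>M N) borel (\<lambda>(\<omega>, \<omega>'). max (A \<omega> * X \<omega>') (B \<omega>))"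
    using sol by (auto simp: max_equation_solution_def)
  interpret N: prob_space N by (rule N)
  interpret P: pair_prob_space M N ..
  have "\<P>(\<omega> in N. X \<omega> > t) = measure (distr N borel X) {t<..}"
    by (simp add: measure_distr vimage_def Int_def conj_commute)
  also have "\<dots> = \<P>(\<omega> in M \<Otimes>\<^sub>M N. A (fst \<omega>) * X (snd \<omega>) > t \<or> B (fst \<omega>) > t)"
    unfolding eq
    by (subst measure_distr) (auto intro!: arg_cong[where f = "measure _"] simp: less_max_iff_disj)
  also have "{\<omega> \<in> space (M \<Otimes>\<^sub>M N). A (fst \<omega>) * X (snd \<omega>) > t \<or> B (fst \<omega>) > t}
    = {\<omega> \<in> space (M \<Otimes>\<^sub>M N). A (fst \<omega>) * X (snd \<omega>) > t}
      \<union> {\<omega> \<in> space (M \<Otimes>\<^sub>M N). B (fst \<omega>) > t \<and> A (fst \<omega>) * X (snd \<omega>) \<le> t}"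
    by auto
  also have "P.prob \<dots> = \<P>(\<omega> in M \<Otimes>\<^sub>M N. A (fst \<omega>) * X (snd \<omega>) > t)
     + \<P>(\<omega> in M \<Otimes>\<^sub>M N. B (fst \<omega>) > t \<and> A (fst \<omega>) * X (snd \<omega>) \<le> t)"
    by (rule P.finite_measure_Union) auto
  finally show ?thesis .
qed

lemma prob_pair_fst:
  assumes "Measurable.pred M Q" "prob_space N"
  shows "\<P>(\<omega> in M \<Otimes>\<^sub>M N. Q (fst \<omega>)) = \<P>(\<omega> in M. Q \<omega>)"
proof -
  interpret M: prob_space M by (rule M)
  interpret N: prob_space N by fact
  have "{\<omega> \<in> space (M \<Otimes>\<^sub>M N). Q (fst \<omega>)} = {\<omega> \<in> space M. Q \<omega>} \<times> space N"
    by (auto simp: space_pair_measure)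
  then show ?thesis
    using assms(1) by (simp add: measure_def N.emeasure_pair_measure_Times N.emeasure_space_1)
qed

text \<open>The maximum is at least \<open>B\<close>. This transfers positivity from
  \<open>B\<close> to \<open>X\<close> when the limit function is shown to be positive.\<close>

lemma prob_B_le_prob_X: "\<P>(\<omega> in M. B \<omega> > t) \<le> \<P>(\<omega> in N. X \<omega> > t)"
proof -
  interpret M: prob_space M by (rule M)
  have N: "prob_space N" and X[measurable]: "X \<in> borel_measurable N"
    using sol by (auto simp: max_equation_solution_def)
  interpret N: prob_space N by (rule N)
  interpret P: pair_prob_space M N ..
  have "\<P>(\<omega> in M. B \<omega> > t) = \<P>(\<omega> in M \<Otimes>\<^sub>M N. B (fst \<omega>) > t)"
    by (rule prob_pair_fst[symmetric]) (simp_all add: N)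
  also have "\<dots> \<le> P.prob ({\<omega> \<in> space (M \<Otimes>\<^sub>M N). A (fst \<omega>) * X (snd \<omega>) > t}
      \<union> {\<omega> \<in> space (M \<Otimes>\<^sub>M N). B (fst \<omega>) > t \<and> A (fst \<omega>) * X (snd \<omega>) \<le> t})"
    by (intro P.finite_measure_mono) auto
  also have "\<dots> = \<P>(\<omega> in N. X \<omega> > t)"
    unfolding tail_decomposition by (rule P.finite_measure_Union) auto
  finally show ?thesis .
qed

lemma lattice_renewal_tail:
  fixes x h \<nu> :: real
  defines "p \<equiv> lattice_mass h (tilted_cdf M A \<kappa>)"
    and "z \<equiv> (\<lambda>n::int. x powr \<kappa> * exp (\<kappa> * of_int n * h) * \<P>(\<omega> in N. X \<omega> > x * exp (of_int n * h)))"
    and "g \<equiv> (\<lambda>n::int. x powr \<kappa> * exp (\<kappa> * of_int n * h) *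
      \<P>(\<omega> in M \<Otimes>\<^sub>M N. B (fst \<omega>) > x * exp (of_int n * h)
        \<and> A (fst \<omega>) * X (snd \<omega>) \<le> x * exp (of_int n * h)))"
  assumes "\<kappa> > 0" and pos: "AE \<omega> in M. A \<omega> \<ge> 0"
    and int: "integrable M (\<lambda>\<omega>. A \<omega> powr \<kappa>)" and \<theta>: "(\<integral>\<omega>. A \<omega> powr \<kappa> \<partial>M) = \<theta>" "0 < \<theta>" "\<theta> < 1"
    and mem: "tilted_cdf M A \<kappa> \<in> h_subexponential h"
    and O: "(\<lambda>n. SUP k\<in>{n..}. p k) \<in> O[at_top](p)"
    and \<nu>: "\<nu> > \<kappa>" and intB: "integrable M (\<lambda>\<omega>. \<bar>B \<omega>\<bar> powr \<nu>)" and x: "x > 0"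
  shows "lattice_renewal p z g \<theta> (\<kappa> * h) (x powr \<kappa>) ((\<nu> - \<kappa>) * h)
    (x powr \<kappa> * ((\<integral>\<omega>. \<bar>B \<omega>\<bar> powr \<nu> \<partial>M) * x powr (- \<nu>)))"
proof -
  interpret M: prob_space M by (rule M)
  have N: "prob_space N" and X[measurable]: "X \<in> borel_measurable N"
    using sol by (auto simp: max_equation_solution_def)
  interpret N: prob_space N by (rule N)
  interpret P: pair_prob_space M N ..
  let ?\<mu> = "tilted_law M A \<kappa>"
  interpret \<mu>: real_distribution ?\<mu>
    by (rule real_distribution_tilted_law[OF A int \<theta>(1,2)])
  have cdf: "cdf ?\<mu> = tilted_cdf M A \<kappa>" by (rule cdf_tilted_law[OF A int \<theta>(1,2)])
  have p: "p k = measure ?\<mu> {of_int k * h}" for k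
    unfolding p_def cdf[symmetric] by (rule \<mu>.lattice_mass_cdf)
  \<comment> \<open>Membership in \<open>h_subexponential\<close> supplies some measure with this
    distribution function. By uniqueness it is the tilted law, which is therefore carried by the
    lattice.\<close>
  have "arithmetic_with_span ?\<mu> h"
    using mem \<mu>.real_distribution_axioms cdf unfolding h_subexponential_def
    by (auto dest: cdf_unique)
  then have h: "h > 0" and ae: "AE y in ?\<mu>. y \<in> integer_multiples h"
    by (auto simp: arithmetic_with_span_def)
  define T where "T t = \<P>(\<omega> in N. X \<omega> > t)" for t
  have T[measurable]: "T \<in> borel_measurable borel"
  proof -
    have "mono (\<lambda>t. - T t)"
      unfolding T_def by (auto simp: mono_def intro!: N.finite_measure_mono)
    from borel_measurable_uminus[OF borel_measurable_mono[OF this]] show ?thesis by simp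
  qed
  have T_bounds: "0 \<le> T t" "T t \<le> 1" for t by (simp_all add: T_def)
  have z: "z n = x powr \<kappa> * exp (\<kappa> * of_int n * h) * T (x * exp (of_int n * h))" for n
    by (simp add: z_def T_def)
  interpret subexponential_masses p
    unfolding p_def by (rule subexponential_masses_of_cdf[OF mem O[unfolded p_def]])
  have mgf: "((\<lambda>k. p k * exp (- (\<kappa> * h) * of_int k)) has_sum \<P>(\<omega> in M. A \<omega> \<noteq> 0) / \<theta>) UNIV"
    using \<mu>.has_sum_lattice[OF h ae, of "\<lambda>y. exp (- \<kappa> * y)"] \<theta>
      nn_integral_tilted_exp[OF A int \<theta>(1,2) M pos]
    by (simp add: p mult_ac)
  show ?thesis
  proof
    show "0 < \<theta>" "\<theta> < 1" "0 < \<kappa> * h" "0 < (\<nu> - \<kappa>) * h" using \<theta> \<open>\<kappa> > 0\<close> h \<nu> by auto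
    show "(\<lambda>k. p k * exp (- (\<kappa> * h) * of_int k)) summable_on UNIV"
      using mgf by (rule has_sum_imp_summable)
    show "\<theta> * (\<Sum>\<^sub>\<infinity>k. p k * exp (- (\<kappa> * h) * of_int k)) \<le> 1"
      unfolding infsumI[OF mgf] using \<theta> by simp
    fix n :: int
    show "0 \<le> z n" by (simp add: z T_bounds)
    show "0 \<le> g n" by (simp add: g_def)
    show "z n \<le> x powr \<kappa> * exp (\<kappa> * h * of_int n)"
    proof -
      have "z n \<le> x powr \<kappa> * exp (\<kappa> * of_int n * h)"
        unfolding z using T_bounds by (intro mult_left_le) auto
      then show ?thesis by (simp add: mult_ac)
    qed
    show "g n \<le> x powr \<kappa> * ((\<integral>\<omega>. \<bar>B \<omega>\<bar> powr \<nu> \<partial>M) * x powr (- \<nu>)) * exp (- ((\<nu> - \<kappa>) * h) * of_int n)"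
    proof -
      let ?t = "x * exp (of_int n * h)"
      \<comment> \<open>The condition on \<open>A * X\<close> is dropped. Markov's inequality of
        order \<open>\<nu>\<close> then outweighs the factor of order \<open>\<kappa>\<close> and
        leaves decay at rate \<open>(\<nu> - \<kappa>) * h\<close>.\<close>
      have "\<P>(\<omega> in M \<Otimes>\<^sub>M N. B (fst \<omega>) > ?t \<and> A (fst \<omega>) * X (snd \<omega>) \<le> ?t)
          \<le> \<P>(\<omega> in M \<Otimes>\<^sub>M N. B (fst \<omega>) > ?t)"
        by (intro P.finite_measure_mono) auto
      also have "\<dots> = \<P>(\<omega> in M. B \<omega> > ?t)"
        by (rule prob_pair_fst) (simp_all add: N)
      also have "\<dots> \<le> (\<integral>\<omega>. \<bar>B \<omega>\<bar> powr \<nu> \<partial>M) * ?t powr (- \<nu>)"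
        using \<nu> \<open>\<kappa> > 0\<close> x by (intro prob_gt_le_moment M B intB) auto
      finally have "g n \<le> x powr \<kappa> * exp (\<kappa> * of_int n * h) * ((\<integral>\<omega>. \<bar>B \<omega>\<bar> powr \<nu> \<partial>M) * ?t powr (- \<nu>))"
        unfolding g_def by (intro mult_left_mono) auto
      also have "?t powr (- \<nu>) = x powr (- \<nu>) * exp (- \<nu> * (of_int n * h))"
        using x by (simp add: powr_mult powr_def[of "exp _"])
      also have "x powr \<kappa> * exp (\<kappa> * of_int n * h) *
          ((\<integral>\<omega>. \<bar>B \<omega>\<bar> powr \<nu> \<partial>M) * (x powr (- \<nu>) * exp (- \<nu> * (of_int n * h))))
        = x powr \<kappa> * ((\<integral>\<omega>. \<bar>B \<omega>\<bar> powr \<nu> \<partial>M) * x powr (- \<nu>)) *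
          (exp (\<kappa> * of_int n * h) * exp (- \<nu> * (of_int n * h)))"
        by (simp only: mult_ac)
      also have "exp (\<kappa> * of_int n * h) * exp (- \<nu> * (of_int n * h)) = exp (- ((\<nu> - \<kappa>) * h) * of_int n)"
        by (simp add: algebra_simps flip: exp_add)
      finally show ?thesis .
    qed
    show "z n = \<theta> * (\<Sum>\<^sub>\<infinity>j. p (n - j) * z j) + g n"
    proof -
      let ?t = "x * exp (of_int n * h)"
      let ?s = "\<P>(\<omega> in M \<Otimes>\<^sub>M N. A (fst \<omega>) * X (snd \<omega>) > ?t)"
      have "(\<integral>\<^sup>+y. ennreal (exp (- \<kappa> * y) * T (?t * exp (- y))) \<partial>?\<mu>) = ennreal (?s / \<theta>)"
        unfolding T_def using x
        by (intro prob_scaled_eq_tilted A int \<theta> N X M pos) auto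
      then have "((\<lambda>k. p k * (exp (- \<kappa> * (of_int k * h)) * T (?t * exp (- (of_int k * h))))) has_sum ?s / \<theta>) UNIV"
        unfolding p using \<theta> T_bounds by (intro \<mu>.has_sum_lattice[OF h ae]) auto
      then have "((\<lambda>k. x powr \<kappa> * exp (\<kappa> * of_int n * h) *
          (p k * (exp (- \<kappa> * (of_int k * h)) * T (?t * exp (- (of_int k * h))))))
          has_sum x powr \<kappa> * exp (\<kappa> * of_int n * h) * (?s / \<theta>)) UNIV"
        by (rule has_sum_cmult_right)
      moreover have "x powr \<kappa> * exp (\<kappa> * of_int n * h) *
          (p k * (exp (- \<kappa> * (of_int k * h)) * T (?t * exp (- (of_int k * h))))) = p k * z (n - k)" for k
      proof -
        \<comment> \<open>Lowering the level by the factor \<open>exp (k * h)\<close> lowers the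
          lattice index by \<open>k\<close>, and the exponential weight splits accordingly; so the
          tilted integral is a convolution with \<open>z\<close>.\<close>
        have 1: "?t * exp (- (of_int k * h)) = x * exp (of_int (n - k) * h)"
          by (simp add: left_diff_distrib exp_diff exp_minus field_simps)
        have 2: "exp (\<kappa> * of_int n * h) * exp (- \<kappa> * (of_int k * h)) = exp (\<kappa> * of_int (n - k) * h)"
          by (simp add: algebra_simps flip: exp_add)
        have "x powr \<kappa> * exp (\<kappa> * of_int n * h) *
            (p k * (exp (- \<kappa> * (of_int k * h)) * T (?t * exp (- (of_int k * h)))))
          = p k * (x powr \<kappa> * (exp (\<kappa> * of_int n * h) * exp (- \<kappa> * (of_int k * h)))
              * T (?t * exp (- (of_int k * h))))"
          by (simp only: mult_ac)
        also have "\<dots> = p k * z (n - k)" unfolding z 1 2 ..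
        finally show ?thesis .
      qed
      ultimately have "((\<lambda>k. p k * z (n - k)) has_sum x powr \<kappa> * exp (\<kappa> * of_int n * h) * (?s / \<theta>)) UNIV"
        by (simp only:)
      then have "((\<lambda>j. p (n - j) * z j) has_sum x powr \<kappa> * exp (\<kappa> * of_int n * h) * (?s / \<theta>)) UNIV"
        by (rule has_sum_reindex_bij_witness[THEN iffD1, rotated -1, of _ _ _ "\<lambda>j. n - j" "\<lambda>j. n - j"]) auto
      then have "\<theta> * (\<Sum>\<^sub>\<infinity>j. p (n - j) * z j) = x powr \<kappa> * exp (\<kappa> * of_int n * h) * ?s"
        using \<theta> by (simp add: infsumI)
      then show ?thesis
        unfolding z g_def T_def tail_decomposition[of ?t] by (simp add: distrib_left)
    qed
  next
    \<comment> \<open>Without its exponential weight, \<open>z n\<close> is a constant times the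
      tail of \<open>X\<close> at a level that tends to infinity.\<close>
    have "filterlim (\<lambda>n::int. x * exp (of_int n * h)) at_top at_top"
      using x h
      by (intro filterlim_tendsto_pos_mult_at_top[OF tendsto_const] filterlim_compose[OF exp_at_top]
          filterlim_at_top_mult_tendsto_pos[OF tendsto_const] filterlim_real_of_int_at_top)
    from filterlim_compose[OF prob_gt_tendsto_0[OF N X] this]
    have "((\<lambda>n::int. x powr \<kappa> * T (x * exp (of_int n * h))) \<longlongrightarrow> x powr \<kappa> * 0) at_top"
      unfolding T_def by (intro tendsto_mult tendsto_const)
    moreover have "exp (- (\<kappa> * h) * of_int n) * z n = x powr \<kappa> * T (x * exp (of_int n * h))" for n
    proof -
      have "exp (- (\<kappa> * h) * of_int n) * exp (\<kappa> * of_int n * h) = 1"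
        by (simp add: algebra_simps flip: exp_add)
      moreover have "exp (- (\<kappa> * h) * of_int n) * z n = (exp (- (\<kappa> * h) * of_int n) * exp (\<kappa> * of_int n * h))
          * (x powr \<kappa> * T (x * exp (of_int n * h)))"
        unfolding z by (simp only: mult_ac)
      ultimately show ?thesis by simp
    qed
    ultimately show "((\<lambda>n. exp (- (\<kappa> * h) * of_int n) * z n) \<longlongrightarrow> 0) at_top" by simp
  qed
qed

end

section \<open>The limit function and its properties\<close>

theorem theorem8:
  fixes M :: "'a measure" and N :: "'b measure"
    and A B :: "'a \<Rightarrow> real" and X :: "'b \<Rightarrow> real"
    and \<kappa> h \<theta> \<nu> :: real and p :: "int \<Rightarrow> real"
  assumes "\<kappa> > 0" and "h > 0"
    and "prob_space M"
    and "A \<in> borel_measurable M" and "B \<in> borel_measurable M"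
    and "AE \<omega> in M. A \<omega> \<ge> 0"
    and "integrable M (\<lambda>\<omega>. A \<omega> powr \<kappa>)"
    and "(\<integral>\<omega>. A \<omega> powr \<kappa> \<partial>M) = \<theta>" and "\<theta> \<in> {0<..<1}"
    and "arithmetic_with_span (log_law_nonzero M A) h"
    and "\<And>n. p n = lattice_mass h (tilted_cdf M A \<kappa>) n"
    and "tilted_cdf M A \<kappa> \<in> h_subexponential h"
    and "(\<lambda>n. SUP k\<in>{n..}. p k) \<in> O[at_top](p)"
    and "\<nu> > \<kappa>" and "integrable M (\<lambda>\<omega>. \<bar>B \<omega>\<bar> powr \<nu>)"
    and "max_equation_solution M A B N X"
  shows "\<exists>q\<in>Q_class \<kappa> h.
     (\<forall>x\<in>continuity_points q.
        ((\<lambda>n::int. inverse (p n) * x powr \<kappa> * exp (\<kappa> * of_int n * h)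
            * \<P>(\<omega> in N. X \<omega> > x * exp (of_int n * h))) \<longlongrightarrow> q x) at_top) \<and>
     ((AE \<omega> in M. B \<omega> \<ge> 0) \<and> \<P>(\<omega> in M. B \<omega> > 0) > 0 \<longrightarrow> (\<forall>x>0. q x > 0))"
proof -
  have p_eq: "p = lattice_mass h (tilted_cdf M A \<kappa>)" using assms(11) by auto
  have \<theta>: "0 < \<theta>" "\<theta> < 1" using assms(9) by auto
  interpret M: prob_space M by fact
  have N: "prob_space N" and X[measurable]: "X \<in> borel_measurable N"
    using assms(16) by (auto simp: max_equation_solution_def)
  interpret N: prob_space N by (rule N)
  define T where "T t = \<P>(\<omega> in N. X \<omega> > t)" for t
  have T_nonneg: "0 \<le> T t" for t by (simp add: T_def)
  have T_antimono: "T t \<le> T s" if "s \<le> t" for s t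
    unfolding T_def using that by (intro N.finite_measure_mono) auto
  define z where "z x n = x powr \<kappa> * exp (\<kappa> * of_int n * h) * T (x * exp (of_int n * h))"
    for x and n :: int
  define q where "q x = \<theta> / (1 - \<theta>) * infsum (z x) UNIV" for x
  have z_nonneg: "0 \<le> z x n" for x n by (simp add: z_def T_nonneg)
  have limit: "((\<lambda>n. z x n / p n) \<longlongrightarrow> q x) at_top" and summable: "z x summable_on UNIV"
    if "x > 0" for x
  proof -
    interpret R: lattice_renewal p "z x"
      "\<lambda>n::int. x powr \<kappa> * exp (\<kappa> * of_int n * h) *
        \<P>(\<omega> in M \<Otimes>\<^sub>M N. B (fst \<omega>) > x * exp (of_int n * h)
          \<and> A (fst \<omega>) * X (snd \<omega>) \<le> x * exp (of_int n * h))"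
      \<theta> "\<kappa> * h" "x powr \<kappa>" "(\<nu> - \<kappa>) * h"
      "x powr \<kappa> * ((\<integral>\<omega>. \<bar>B \<omega>\<bar> powr \<nu> \<partial>M) * x powr (- \<nu>))"
      unfolding z_def[abs_def] T_def p_eq
      using assms \<theta> that by (intro lattice_renewal_tail) (auto simp: p_eq)
    show "((\<lambda>n. z x n / p n) \<longlongrightarrow> q x) at_top" unfolding q_def by (rule R.renewal_limit)
    show "z x summable_on UNIV" by (rule R.summable_z)
  qed
  have "q \<in> Q_class \<kappa> h"
    unfolding Q_class_def
  proof (intro CollectI conjI allI impI)
    show "0 \<le> q x" for x
      unfolding q_def using \<theta> by (intro mult_nonneg_nonneg infsum_nonneg z_nonneg) auto
    show "antimono_on {0<..} (\<lambda>x. x powr - \<kappa> * q x)"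
    proof (rule monotone_onI)
      fix x y :: real assume xy: "x \<in> {0<..}" "y \<in> {0<..}" "x \<le> y"
      have "(\<Sum>\<^sub>\<infinity>n. y powr - \<kappa> * z y n) \<le> (\<Sum>\<^sub>\<infinity>n. x powr - \<kappa> * z x n)"
      proof (intro infsum_mono summable_on_cmult_right summable)
        fix n
        \<comment> \<open>Once the prefactor is cancelled, \<open>w\<close> enters only through the
          tail of \<open>X\<close>, so the monotonicity holds term by term.\<close>
        have "w powr - \<kappa> * z w n = exp (\<kappa> * of_int n * h) * T (w * exp (of_int n * h))"
          if "w > 0" for w
          using that by (simp add: z_def powr_minus)
        then show "y powr - \<kappa> * z y n \<le> x powr - \<kappa> * z x n"
          using xy by (simp add: T_antimono mult_right_mono)
      qed (use xy in auto)
      then have "y powr - \<kappa> * infsum (z y) UNIV \<le> x powr - \<kappa> * infsum (z x) UNIV"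
        by (simp add: infsum_cmult_right')
      from mult_left_mono[OF this, of "\<theta> / (1 - \<theta>)"]
      show "y powr - \<kappa> * q y \<le> x powr - \<kappa> * q x"
        using \<theta> by (simp add: q_def mult_ac)
    qed
    show "q (x * exp h) = q x" if "x > 0" for x
    proof -
      \<comment> \<open>Multiplying \<open>x\<close> by \<open>exp h\<close> moves every level to
        the next lattice index, so the sum over all integers is merely reindexed.\<close>
      have "z (x * exp h) n = z x (n + 1)" for n
      proof -
        have "(x * exp h) powr \<kappa> = x powr \<kappa> * exp (\<kappa> * h)"
          using that by (simp add: powr_mult powr_def[of "exp _"])
        then show ?thesis
          by (simp add: z_def algebra_simps flip: exp_add)
      qed
      moreover have "(\<Sum>\<^sub>\<infinity>n. z x (n + 1)) = infsum (z x) UNIV"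
        by (rule infsum_reindex_bij_witness[of _ "\<lambda>n. n - 1" "\<lambda>n. n + 1"]) auto
      ultimately show ?thesis unfolding q_def by presburger
    qed
  qed
  moreover have "((\<lambda>n::int. inverse (p n) * x powr \<kappa> * exp (\<kappa> * of_int n * h)
      * \<P>(\<omega> in N. X \<omega> > x * exp (of_int n * h))) \<longlongrightarrow> q x) at_top"
    if "x \<in> continuity_points q" for x
    using limit[of x] that by (simp add: continuity_points_def z_def T_def divide_inverse mult_ac)
  moreover have "q x > 0" if B_pos: "\<P>(\<omega> in M. B \<omega> > 0) > 0" and x: "x > 0" for x
  proof (rule ccontr)
    assume "\<not> 0 < q x"
    then have "infsum (z x) UNIV \<le> 0"
      using \<theta> by (simp add: q_def zero_less_mult_iff zero_less_divide_iff not_less)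
    then have "z x n = 0" for n
      by (rule nonneg_infsum_le_0D[OF _ summable[OF x]]) (auto simp: z_nonneg)
    then have zero: "T (x * exp (of_int n * h)) = 0" for n :: int
      using x by (auto simp: z_def)
    \<comment> \<open>Countably many null events suffice, along levels that decrease to 0 because
      \<open>h > 0\<close>.\<close>
    have "AE \<omega> in N. \<forall>m::nat. X \<omega> \<le> x * exp (of_int (- int m) * h)"
    proof (rule AE_all_countable[THEN iffD2], rule allI)
      fix m :: nat
      show "AE \<omega> in N. X \<omega> \<le> x * exp (of_int (- int m) * h)"
        using zero[of "- int m"] unfolding T_def
        by (subst (asm) N.prob_eq_0) (auto simp: not_less)
    qed
    moreover have "(\<lambda>m. x * exp (of_int (- int m) * h)) \<longlonglongrightarrow> x * 0"
    proof (intro tendsto_mult tendsto_const filterlim_compose[OF exp_at_bot])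
      show "filterlim (\<lambda>m. of_int (- int m) * h) at_bot sequentially"
        using assms(2) by real_asymp
    qed
    ultimately have "AE \<omega> in N. X \<omega> \<le> 0"
      by (auto elim!: eventually_mono intro: LIMSEQ_le_const)
    then have "T 0 = 0"
      unfolding T_def by (subst N.prob_eq_0) (auto simp: not_less)
    moreover have "\<P>(\<omega> in M. B \<omega> > 0) \<le> T 0"
      unfolding T_def using assms by (intro prob_B_le_prob_X)
    ultimately show False using B_pos by simp
  qed
  ultimately show ?thesis by blast
qed

end
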